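(* Let $\theta=\cos^{-1}\!\left(\frac{1}{2\sqrt{2}}\right)$. For every integer $n\ge 1$, \begin{align*} S_2(n;1)&=\frac{1}{4n}\sum_{j\mid n}[\![2\nmid j]\!]\,\mu(j) \left(2^{n/j}+1-(-1)^{n/j}2^{(n/2j)+1}\cos(n\theta/j)\right),\\ S_2(n;0)&=\frac{1}{4n}\sum_{j\mid n}[\![2\nmid j]\!]\,\mu(j) \left(2^{n/j}-1+(-1)^{n/j}2^{(n/2j)+1}\cos(n\theta/j)\right), \end{align*} where the sums are over positive divisors $j$ of $n$.
   Context: A monic polynomial $f\in\mathbb{F}_2[x]$ is self-reciprocal if $x^{\deg f}f(1/x)=f(x)$. For $a\in\mathbb{F}_2$, $S_2(n;a)$ denotes the number of self-reciprocal monic irreducible polynomials $f\in\mathbb{F}_2[x]$ of degree $2n$ with $[x^{2n-1}]f=a$. $\mu$ is the Möbius function, and $[\![P]\!]$ is $1$ if $P$ is true and $0$ otherwise. *)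

theory Defs
  imports Complex_Main "HOL-Computational_Algebra.Computational_Algebra" "HOL-Library.Z2"
begin

definition moebius_mu :: "nat \<Rightarrow> int" where
  "moebius_mu n = (if squarefree n then (-1) ^ card (prime_factors n) else 0)"

text \<open>Self-reciprocal: x^(deg f) f(1/x) = f(x); reflect_poly f is exactly x^(deg f) f(1/x).\<close>
definition self_reciprocal :: "'a::comm_semiring_1 poly \<Rightarrow> bool" where
  "self_reciprocal f \<longleftrightarrow> reflect_poly f = f"

definition S2 :: "nat \<Rightarrow> bit \<Rightarrow> nat" where
  "S2 n a = card {f :: bit poly. lead_coeff f = 1 \<and> irreducible f \<and> degree f = 2 * n
      \<and> self_reciprocal f \<and> coeff f (2 * n - 1) = a}"

end

theory Submission
  imports Defs
begin

text \<open>
  Count factorizations in two graded monoids of binary polynomials: all nonzero polynomials, and the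
  self-reciprocal ones of even degree. In the latter the primes are the self-reciprocal irreducibles,
  the products of an irreducible with its different reciprocal, and \<open>(x + 1)\<^sup>2\<close>. In each monoid take the
  logarithmic derivative of the Euler product, once with trivial weight and once with the sign given
  by the coefficient of \<open>x\<close> (times, in the first monoid, the sign of the coefficient of \<open>x\<close> in the
  reciprocal). The weighted counts by degree are geometric or vanish from some degree on; the only
  interesting one is \<open>1 + T + 2 * T\<^sup>2\<close>, whose inverse roots have argument \<open>\<plusminus>(pi - \<theta>)\<close>. The contributions
  of the non-self-reciprocal irreducibles cancel between the monoids, which leaves the sum of
  \<open>d * S2 d a\<close> over \<open>d dvd n\<close> with \<open>n div d\<close> odd, and Moebius inversion finishes.
\<close>

section \<open>Factorization of binary polynomials\<close>

lemma bit_poly_lead_coeff [simp]: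
  fixes F :: "bit poly" shows "F \<noteq> 0 \<Longrightarrow> lead_coeff F = 1"
  using bit_not_zero_iff leading_coeff_neq_0 by blast

lemma bit_poly_degree_0_iff:
  fixes F :: "bit poly" assumes "F \<noteq> 0" shows "degree F = 0 \<longleftrightarrow> F = 1"
proof
  assume "degree F = 0"
  then obtain a where "F = [:a:]" by (rule degree_eq_zeroE)
  with assms show "F = 1" by (simp add: one_pCons)
qed simp

text \<open>The only nonzero constant over the two-element field is 1. Associated polynomials are
  therefore equal, and irreducibles can be counted without choosing representatives.\<close>

lemma bit_poly_unit_iff [simp]:
  fixes F :: "bit poly" shows "is_unit F \<longleftrightarrow> F = 1"
proof (cases "F = 0")
  case False
  then show ?thesis by (simp add: is_unit_iff_degree bit_poly_degree_0_iff)
qed simp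

lemma irreducible_dvd_irreducible:
  fixes P Q :: "bit poly"
  assumes "irreducible P" "irreducible Q" "P dvd Q"
  shows "P = Q"
proof -
  obtain A where A: "Q = P * A" using assms(3) by blast
  then have "P = 1 \<or> A = 1" using irreducibleD[OF assms(2) A] by simp
  with A assms(1) show ?thesis by (auto simp: irreducible_def)
qed

lemma irreducible_degree_pos:
  fixes P :: "bit poly" shows "irreducible P \<Longrightarrow> degree P > 0"
  using bit_poly_degree_0_iff[of P] by (auto simp: irreducible_def)

lemma exists_irreducible_dvd:
  fixes F :: "bit poly"
  assumes "F \<noteq> 0" "F \<noteq> 1"
  shows "\<exists>P. irreducible P \<and> P dvd F"
  using assms
proof (induction "degree F" arbitrary: F rule: less_induct)
  case less
  show ?case
  proof (cases "irreducible F")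
    case False
    then obtain A B where AB: "F = A * B" "A \<noteq> 1" "B \<noteq> 1"
      using less.prems by (auto simp: irreducible_def)
    with less.prems have "A \<noteq> 0" "B \<noteq> 0" by auto
    with AB have "degree A < degree F"
      using bit_poly_degree_0_iff by (auto simp: degree_mult_eq)
    with less.hyps[of A] AB \<open>A \<noteq> 0\<close> show ?thesis by auto
  qed auto
qed

section \<open>Multiplicities of irreducible factors\<close>

lemma prime_power_dvd_mult_cancel:
  fixes P :: "'a :: algebraic_semidom"
  assumes "prime_elem P" "\<not> P dvd A" "P ^ k dvd A * B"
  shows "P ^ k dvd B"
  using assms(3)
proof (induction k arbitrary: B)
  case (Suc k)
  have "P dvd A * B" using Suc.prems by (metis dvd_trans dvd_triv_left power_Suc)
  then have "P dvd B" using assms(1,2) by (simp add: prime_elem_dvd_mult_iff)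
  then obtain C where C: "B = P * C" ..
  from assms(1) have "P \<noteq> 0" by auto
  moreover have "P * P ^ k dvd P * (A * C)" using Suc.prems C by (simp add: mult_ac)
  ultimately have "P ^ k dvd A * C" by (rule dvd_times_left_cancel_iff[THEN iffD1])
  then have "P ^ k dvd C" by (rule Suc.IH)
  then show ?case unfolding C power_Suc by (rule mult_dvd_mono[OF dvd_refl])
qed simp

lemma irreducible_power_dvd_mult_iff:
  fixes P Q :: "bit poly"
  assumes "irreducible P" "irreducible Q" "P \<noteq> Q"
  shows "P ^ k dvd Q ^ l * F \<longleftrightarrow> P ^ k dvd F"
proof -
  have pr: "prime_elem P" by (rule field_poly_irreducible_imp_prime) fact
  have "\<not> P dvd Q ^ l"
    using assms irreducible_dvd_irreducible prime_elem_dvd_power[OF pr] by blast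
  then show ?thesis using prime_power_dvd_mult_cancel[OF pr] dvd_mult by blast
qed

text \<open>For nonzero \<open>F\<close>, an irreducible \<open>P\<close> appears here once for each
  \<open>k\<close> from 1 up to its multiplicity in \<open>F\<close>, so a plain sum over this set
  is already weighted by multiplicity.\<close>

definition irred_powers :: "bit poly \<Rightarrow> (bit poly \<times> nat) set" where
  "irred_powers F = {(P, k). irreducible P \<and> 1 \<le> k \<and> P ^ k dvd F}"

text \<open>The extra factor moves every exponent of \<open>Q\<close> up by one, which frees the
  place \<open>(Q, 1)\<close>; by coprimality the exponents of the other irreducibles stay the
  same.\<close>

lemma irred_powers_mult:
  assumes "irreducible Q"
  shows "irred_powers (Q * F) = insert (Q, 1) ((\<lambda>(P, k). (P, if P = Q then Suc k else k)) ` irred_powers F)"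
    (is "?L = insert _ (?g ` _)")
proof (intro equalityI subsetI)
  fix z assume "z \<in> ?L"
  then obtain P k where z: "z = (P, k)" "irreducible P" "1 \<le> k" "P ^ k dvd Q * F"
    by (auto simp: irred_powers_def)
  have "Q \<noteq> 0" using assms by auto
  show "z \<in> insert (Q, 1) (?g ` irred_powers F)"
  proof (cases "P = Q")
    case True
    obtain l where l: "k = Suc l" using z by (cases k) auto
    with z True \<open>Q \<noteq> 0\<close> have "Q ^ l dvd F" by simp
    then show ?thesis
    proof (cases "l = 0")
      case False
      then have "(Q, l) \<in> irred_powers F"
        using assms \<open>Q ^ l dvd F\<close> by (auto simp: irred_powers_def)
      then show ?thesis using z True l by force
    qed (use z True l in auto)
  next
    case False
    then have "(P, k) \<in> irred_powers F"
      using z irreducible_power_dvd_mult_iff[OF z(2) assms False, of k 1 F]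
      by (auto simp: irred_powers_def)
    then show ?thesis using z False by force
  qed
next
  fix z assume "z \<in> insert (Q, 1) (?g ` irred_powers F)"
  then show "z \<in> ?L"
    using assms by (auto simp: irred_powers_def split: if_splits)
qed

lemma irred_powers_degree_sum:
  assumes "F \<noteq> 0"
  shows "finite (irred_powers F) \<and> (\<Sum>(P, k)\<in>irred_powers F. degree P) = degree F"
  using assms
proof (induction "degree F" arbitrary: F rule: less_induct)
  case less
  show ?case
  proof (cases "F = 1")
    case True
    have "irred_powers 1 = {}"
      by (auto simp: irred_powers_def is_unit_power_iff irreducible_not_unit simp del: bit_poly_unit_iff)
    with True show ?thesis by simp
  next
    case False
    then obtain Q G where Q: "irreducible Q" "F = Q * G"
      using exists_irreducible_dvd less.prems by (metis dvdE)
    let ?g = "\<lambda>(P, k). (P, if P = Q then Suc k else k)"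
    have "G \<noteq> 0" using less.prems Q by auto
    have dF: "degree F = degree Q + degree G"
      using Q less.prems by (simp add: degree_mult_eq)
    with irreducible_degree_pos[OF Q(1)] have "degree G < degree F" by simp
    from less.hyps[OF this \<open>G \<noteq> 0\<close>] have IH: "finite (irred_powers G)"
      "(\<Sum>(P, k)\<in>irred_powers G. degree P) = degree G" by auto
    have inj: "inj_on ?g (irred_powers G)" by (auto simp: inj_on_def split: if_splits)
    have notin: "(Q, 1) \<notin> ?g ` irred_powers G" by (auto simp: irred_powers_def split: if_splits)
    have "(\<Sum>(P, k)\<in>?g ` irred_powers G. degree P) = degree G"
      using IH(2) unfolding sum.reindex[OF inj] by (simp add: case_prod_unfold o_def)
    with IH(1) notin show ?thesis
      unfolding dF unfolding Q(2) irred_powers_mult[OF Q(1)] by (subst sum.insert) auto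
  qed
qed

text \<open>The logarithmic derivative of an Euler product, read coefficientwise: \<open>N P k\<close> is the least
  element of the monoid \<open>M\<close> that \<open>P ^ k\<close> divides.\<close>

lemma euler_product_log_deriv:
  fixes w :: "bit poly \<Rightarrow> int" and M I :: "bit poly set" and N :: "bit poly \<Rightarrow> nat \<Rightarrow> bit poly"
  defines "c \<equiv> \<lambda>m. \<Sum>F | F \<in> M \<and> degree F = m. w F"
    and "p \<equiv> \<lambda>m. \<Sum>(P, k) | P \<in> I \<and> 1 \<le> k \<and> degree (N P k) = m. int (degree P) * w (N P k)"
  assumes fin: "\<And>m. finite {F \<in> M. degree F = m}" and M0: "0 \<notin> M"
    and wmult: "\<And>F G. F \<in> M \<Longrightarrow> G \<in> M \<Longrightarrow> w (F * G) = w F * w G"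
    and Mmult: "\<And>F G. F \<in> M \<Longrightarrow> G \<in> M \<Longrightarrow> F * G \<in> M"
    and Mdiv: "\<And>F G. F \<in> M \<Longrightarrow> F * G \<in> M \<Longrightarrow> G \<in> M"
    and irr: "\<And>P. P \<in> I \<Longrightarrow> irreducible P"
    and NM: "\<And>P k. P \<in> I \<Longrightarrow> 1 \<le> k \<Longrightarrow> N P k \<in> M"
    and N: "\<And>P k F. P \<in> I \<Longrightarrow> 1 \<le> k \<Longrightarrow> F \<in> M \<Longrightarrow> P ^ k dvd F \<longleftrightarrow> N P k dvd F"
    and nI: "\<And>P F. irreducible P \<Longrightarrow> P \<notin> I \<Longrightarrow> F \<in> M \<Longrightarrow> \<not> P dvd F"
  shows "int n * c n = (\<Sum>m=1..n. p m * c (n - m))"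
proof -
  define J where "J = {(P, k). P \<in> I \<and> 1 \<le> k \<and> degree (N P k) \<le> n}"
  define h where "h = (\<lambda>z :: bit poly \<times> nat. N (fst z) (snd z))"
  define Mn where "Mn = (\<lambda>m. {F \<in> M. degree F = m})"
  have finM: "finite (Mn m)" for m unfolding Mn_def by (rule fin)
  \<comment> \<open>Since \<open>P ^ k\<close> divides \<open>N P k\<close>, every
    \<open>N P k\<close> has positive degree; hence the convolution starts at
    \<open>m = 1\<close>.\<close>
  have dN: "degree P * k \<le> degree (N P k)" if "P \<in> I" "1 \<le> k" for P k
  proof -
    have "P ^ k dvd N P k" using N[OF that NM[OF that]] by simp
    moreover have "N P k \<noteq> 0" using NM[OF that] M0 by metis
    ultimately have "degree (P ^ k) \<le> degree (N P k)" by (rule dvd_imp_degree_le)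
    then show ?thesis using irr[OF that(1)] by (simp add: degree_power_eq irreducible_def mult.commute)
  qed
  have J_of: "(P, k) \<in> J" if "F \<in> Mn n" "(P, k) \<in> irred_powers F" for F P k
  proof -
    have F: "F \<in> M" "degree F = n" and P: "irreducible P" "1 \<le> k" "P ^ k dvd F"
      using that by (auto simp: Mn_def irred_powers_def)
    have "P dvd F" using P by (metis dvd_power dvd_trans less_eq_Suc_le One_nat_def)
    then have "P \<in> I" using nI P F by blast
    then have "N P k dvd F" using N P F by blast
    then have "degree (N P k) \<le> n" using F M0 by (metis dvd_imp_degree_le)
    then show ?thesis using \<open>P \<in> I\<close> P by (simp add: J_def)
  qed
  have J_eq: "J \<inter> irred_powers F = irred_powers F" if "F \<in> Mn n" for F
    using J_of[OF that] by auto
  \<comment> \<open>Every pair in \<open>J\<close> lies in \<open>irred_powers\<close> of its own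
    \<open>N P k\<close>, and there are only finitely many members of \<open>M\<close> of degree at
    most \<open>n\<close>.\<close>
  have finJ: "finite J"
  proof (rule finite_subset)
    show "J \<subseteq> (\<Union>F\<in>\<Union>m\<in>{..n}. Mn m. irred_powers F)"
    proof
      fix z assume "z \<in> J"
      then obtain P k where z: "z = (P, k)" "P \<in> I" "1 \<le> k" "degree (N P k) \<le> n"
        by (auto simp: J_def)
      then have "(P, k) \<in> irred_powers (N P k)"
        using N[OF z(2,3) NM[OF z(2,3)]] irr by (auto simp: irred_powers_def)
      then show "z \<in> (\<Union>F\<in>\<Union>m\<in>{..n}. Mn m. irred_powers F)"
        using z NM by (auto simp: Mn_def)
    qed
    show "finite (\<Union>F\<in>\<Union>m\<in>{..n}. Mn m. irred_powers F)"
    proof (intro finite_UN_I)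
      fix F assume "F \<in> (\<Union>m\<in>{..n}. Mn m)"
      then have "F \<noteq> 0" using M0 by (auto simp: Mn_def)
      then show "finite (irred_powers F)" using irred_powers_degree_sum by blast
    qed (use finM in auto)
  qed
  \<comment> \<open>The members of \<open>M\<close> of degree \<open>n\<close> that
    \<open>P ^ k\<close> divides are the products of \<open>N P k\<close> with members of
    \<open>M\<close> of the complementary degree, and the weight splits along this product.\<close>
  have inner: "(\<Sum>F | F \<in> Mn n \<and> z \<in> irred_powers F. w F) = w (h z) * c (n - degree (h z))"
    if "z \<in> J" for z
  proof -
    obtain P k where z: "z = (P, k)" "P \<in> I" "1 \<le> k" "degree (N P k) \<le> n"
      using \<open>z \<in> J\<close> by (auto simp: J_def)
    have NM': "N P k \<in> M" and N0: "N P k \<noteq> 0" using NM z M0 by metis+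
    have "{F. F \<in> Mn n \<and> z \<in> irred_powers F} = (\<lambda>G. N P k * G) ` Mn (n - degree (N P k))"
    proof (intro equalityI subsetI)
      fix F assume "F \<in> {F. F \<in> Mn n \<and> z \<in> irred_powers F}"
      then have F: "F \<in> M" "degree F = n" "P ^ k dvd F" by (auto simp: Mn_def irred_powers_def z)
      then obtain G where G: "F = N P k * G" using N z by (metis dvdE)
      have "G \<in> M" using Mdiv NM' F G by blast
      moreover have "F \<noteq> 0" using F M0 by metis
      then have "degree G = n - degree (N P k)" using F G by (auto simp: degree_mult_eq)
      ultimately show "F \<in> (\<lambda>G. N P k * G) ` Mn (n - degree (N P k))"
        using G by (auto simp: Mn_def)
    next
      fix F assume "F \<in> (\<lambda>G. N P k * G) ` Mn (n - degree (N P k))"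
      then obtain G where G: "G \<in> M" "degree G = n - degree (N P k)" "F = N P k * G"
        by (auto simp: Mn_def)
      then have "G \<noteq> 0" using M0 by metis
      with G have "F \<in> M" "degree F = n" using Mmult NM' N0 z(4)
        by (auto simp: degree_mult_eq)
      moreover have "P ^ k dvd F" using N z \<open>F \<in> M\<close> G by simp
      ultimately show "F \<in> {F. F \<in> Mn n \<and> z \<in> irred_powers F}"
        using z irr by (auto simp: Mn_def irred_powers_def)
    qed
    moreover have "inj_on (\<lambda>G. N P k * G) (Mn (n - degree (N P k)))"
      using N0 by (auto simp: inj_on_def)
    ultimately have "(\<Sum>F | F \<in> Mn n \<and> z \<in> irred_powers F. w F) = (\<Sum>G\<in>Mn (n - degree (N P k)). w (N P k * G))"
      by (simp add: sum.reindex)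
    also have "\<dots> = (\<Sum>G\<in>Mn (n - degree (N P k)). w (N P k) * w G)"
      using wmult NM' by (intro sum.cong) (auto simp: Mn_def)
    finally show ?thesis by (simp add: c_def Mn_def h_def z sum_distrib_left)
  qed
  have "int n * c n = (\<Sum>F\<in>Mn n. w F * int (degree F))"
    by (simp add: c_def Mn_def sum_distrib_left mult.commute)
  \<comment> \<open>The degree of \<open>F\<close> is the total degree of its irreducible factors
    with multiplicity. The exchange of sums that follows puts the powers of irreducibles
    outside.\<close>
  also have "\<dots> = (\<Sum>F\<in>Mn n. \<Sum>z\<in>irred_powers F. w F * int (degree (fst z)))"
  proof (rule sum.cong[OF refl])
    fix F assume "F \<in> Mn n"
    then have "F \<noteq> 0" using M0 by (auto simp: Mn_def)
    from conjunct2[OF irred_powers_degree_sum[OF this], symmetric]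
    show "w F * int (degree F) = (\<Sum>z\<in>irred_powers F. w F * int (degree (fst z)))"
      by (simp add: sum_distrib_left case_prod_unfold)
  qed
  also have "\<dots> = (\<Sum>F\<in>Mn n. \<Sum>z | z \<in> J \<and> z \<in> irred_powers F. w F * int (degree (fst z)))"
    using J_eq by (intro sum.cong) (auto simp: Int_def)
  also have "\<dots> = (\<Sum>z\<in>J. \<Sum>F | F \<in> Mn n \<and> z \<in> irred_powers F. w F * int (degree (fst z)))"
    by (rule sum.swap_restrict[OF finM finJ])
  also have "\<dots> = (\<Sum>z\<in>J. int (degree (fst z)) * w (h z) * c (n - degree (h z)))"
    using inner by (intro sum.cong) (auto simp: mult_ac simp flip: sum_distrib_right)
  also have "\<dots> = (\<Sum>m=1..n. \<Sum>z | z \<in> J \<and> degree (h z) = m. int (degree (fst z)) * w (h z) * c (n - degree (h z)))"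
  proof (rule sum.group[symmetric])
    show "(\<lambda>z. degree (h z)) ` J \<subseteq> {1..n}"
    proof safe
      fix P k assume "(P, k) \<in> J"
      then have z: "P \<in> I" "1 \<le> k" "degree (N P k) \<le> n" by (auto simp: J_def)
      then have "0 < degree P * k" using irreducible_degree_pos irr by simp
      with dN[OF z(1,2)] have "0 < degree (N P k)" by linarith
      with z(3) show "degree (h (P, k)) \<in> {1..n}" by (simp add: h_def)
    qed
  qed (use finJ in auto)
  also have "\<dots> = (\<Sum>m=1..n. p m * c (n - m))"
  proof (rule sum.cong[OF refl])
    fix m assume m: "m \<in> {1..n}"
    then have "{z \<in> J. degree (h z) = m} = {(P, k). P \<in> I \<and> 1 \<le> k \<and> degree (N P k) = m}"
      by (auto simp: J_def h_def)
    then show "(\<Sum>z | z \<in> J \<and> degree (h z) = m. int (degree (fst z)) * w (h z) * c (n - degree (h z)))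
        = p m * c (n - m)"
      unfolding p_def sum_distrib_right by (intro sum.cong) (auto simp: h_def)
  qed
  finally show ?thesis .
qed

section \<open>The monoid of self-reciprocal polynomials of even degree\<close>

definition set_poly :: "nat set \<Rightarrow> bit poly" where
  "set_poly B = (\<Sum>i\<in>B. monom 1 i)"

lemma coeff_set_poly: "finite B \<Longrightarrow> coeff (set_poly B) i = of_bool (i \<in> B)"
  by (simp add: set_poly_def coeff_sum sum.delta)

lemma set_poly_support: "set_poly {i. coeff F i = 1} = F"
proof -
  have "finite {i. coeff F i = 1}"
    by (rule finite_subset[of _ "{..degree F}"]) (auto intro: le_degree)
  then show ?thesis by (intro poly_eqI) (simp add: coeff_set_poly)
qed

lemma degree_set_poly: "finite B \<Longrightarrow> n \<in> B \<Longrightarrow> B \<subseteq> {..n} \<Longrightarrow> degree (set_poly B) = n"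
  by (intro antisym degree_le le_degree) (auto simp: coeff_set_poly)

lemma finite_degree_le: "finite {F :: bit poly. degree F \<le> n}"
proof (rule finite_subset)
  show "{F :: bit poly. degree F \<le> n} \<subseteq> set_poly ` Pow {..n}"
  proof
    fix F :: "bit poly" assume "F \<in> {F. degree F \<le> n}"
    then have "{i. coeff F i = 1} \<subseteq> {..n}" using le_degree[of F] by force
    then show "F \<in> set_poly ` Pow {..n}" using set_poly_support[of F] by (metis PowI imageI)
  qed
qed simp

lemma finite_degree_eq: "finite {F :: bit poly. P F \<and> degree F = n}"
  by (rule finite_subset[OF _ finite_degree_le[of n]]) auto

lemma irreducible_coeff_0:
  fixes P :: "bit poly"
  assumes "irreducible P" "P \<noteq> [:0, 1:]" shows "coeff P 0 = 1"
proof (rule ccontr)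
  assume "coeff P 0 \<noteq> 1"
  then have "poly P 0 = 0" by (simp add: poly_0_coeff_0)
  then have "[:0, 1:] dvd P" by (simp add: poly_eq_0_iff_dvd)
  with assms show False
    using irreducible_dvd_irreducible[of "[:0, 1:]" P] irreducible_linear_field_poly[of 1 0] by auto
qed

text \<open>Reflection is multiplicative and, on polynomials with constant coefficient 1, an
  involution. A factorization of the reflection thus reflects back to one of
  \<open>P\<close>.\<close>

lemma irreducible_reflect_poly:
  fixes P :: "bit poly"
  assumes "irreducible P" "coeff P 0 = 1" shows "irreducible (reflect_poly P)"
proof (rule irreducibleI)
  have "P \<noteq> 0" using assms by auto
  then show "reflect_poly P \<noteq> 0" by simp
  have "degree (reflect_poly P) > 0" using irreducible_degree_pos assms by simp
  then show "\<not> is_unit (reflect_poly P)" by auto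
  fix A B assume AB: "reflect_poly P = A * B"
  have "coeff (reflect_poly P) 0 = 1" using \<open>P \<noteq> 0\<close> by simp
  with AB have AB0: "coeff A 0 = 1" "coeff B 0 = 1" by (auto simp: coeff_mult_0)
  have "P = reflect_poly (reflect_poly P)" using assms by simp
  also have "\<dots> = reflect_poly A * reflect_poly B" unfolding AB by (rule reflect_poly_mult)
  finally have "reflect_poly A = 1 \<or> reflect_poly B = 1" using irreducibleD[OF assms(1)] by auto
  then have "A = 1 \<or> B = 1" using AB0 by (metis reflect_poly_1 reflect_poly_reflect_poly zero_neq_one)
  then show "is_unit A \<or> is_unit B" by simp
qed

section \<open>Self-reciprocal polynomials\<close>

lemma self_reciprocal_coeff_0:
  fixes F :: "bit poly" shows "self_reciprocal F \<Longrightarrow> F \<noteq> 0 \<Longrightarrow> coeff F 0 = 1"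
  by (metis self_reciprocal_def coeff_0_reflect_poly bit_poly_lead_coeff)

lemma self_reciprocal_coeff:
  "self_reciprocal F \<Longrightarrow> i \<le> degree F \<Longrightarrow> coeff F (degree F - i) = coeff F i"
  by (metis coeff_reflect_poly not_le self_reciprocal_def)

lemma self_reciprocal_1: "self_reciprocal (1 :: 'a :: comm_semiring_1 poly)"
  by (simp add: self_reciprocal_def)

lemma self_reciprocal_mult:
  fixes F G :: "bit poly"
  shows "self_reciprocal F \<Longrightarrow> self_reciprocal G \<Longrightarrow> self_reciprocal (F * G)"
  by (simp add: self_reciprocal_def reflect_poly_mult)

lemma self_reciprocal_power:
  fixes F :: "bit poly" shows "self_reciprocal F \<Longrightarrow> self_reciprocal (F ^ k)"
  by (simp add: self_reciprocal_def reflect_poly_power)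

lemma self_reciprocal_cancel:
  fixes F G :: "bit poly"
  shows "self_reciprocal F \<Longrightarrow> F \<noteq> 0 \<Longrightarrow> self_reciprocal (F * G) \<Longrightarrow> self_reciprocal G"
  by (simp add: self_reciprocal_def reflect_poly_mult)

lemma self_reciprocal_X_plus_1: "self_reciprocal [:1, 1 :: bit:]"
  by (simp add: self_reciprocal_def reflect_poly_def one_pCons)

lemma not_self_reciprocal_X: "\<not> self_reciprocal [:0, 1 :: bit:]"
  using self_reciprocal_coeff_0[of "[:0, 1:]"] by auto

text \<open>In odd degree the symmetry pairs all coefficients with none left in the middle, so their
  sum, the value at 1, vanishes in characteristic 2.\<close>

lemma self_reciprocal_odd_degree:
  fixes F :: "bit poly"
  assumes "self_reciprocal F" "odd (degree F)"
  shows "[:1, 1:] dvd F"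
proof -
  obtain k where k: "degree F = 2 * k + 1" using assms(2) by (elim oddE)
  have "poly F 1 = (\<Sum>i\<le>degree F. coeff F i)"
    by (simp only: poly_altdef power_one mult_1_right)
  also have "{..degree F} = {..k} \<union> {k+1..2 * k + 1}" using k by auto
  also have "(\<Sum>i\<in>{..k} \<union> {k+1..2 * k + 1}. coeff F i) = (\<Sum>i\<le>k. coeff F i) + (\<Sum>i=k+1..2*k+1. coeff F i)"
    by (rule sum.union_disjoint) auto
  also have "(\<Sum>i=k+1..2*k+1. coeff F i) = (\<Sum>i\<le>k. coeff F i)"
    by (rule sum.reindex_bij_witness[of _ "\<lambda>i. 2 * k + 1 - i" "\<lambda>i. 2 * k + 1 - i"])
      (use self_reciprocal_coeff[OF assms(1)] k in auto)
  also have "(\<Sum>i\<le>k. coeff F i) + (\<Sum>i\<le>k. coeff F i) = 0"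
    by (metis bit_2_eq_0 mult_2 mult_zero_left)
  finally have "poly F 1 = 0" .
  then show ?thesis by (simp add: poly_eq_0_iff_dvd)
qed

text \<open>\<open>x + 1\<close> is set apart as the only self-reciprocal irreducible of odd degree.
  Below, \<open>x\<close> is set apart because its reflection is the constant 1.\<close>

definition SRI :: "bit poly set" where
  "SRI = {P. irreducible P \<and> self_reciprocal P \<and> P \<noteq> [:1, 1:]}"

definition NSRI :: "bit poly set" where
  "NSRI = {P. irreducible P \<and> \<not> self_reciprocal P \<and> P \<noteq> [:0, 1:]}"

lemma irreducible_X_plus_1: "irreducible [:1, 1 :: bit:]"
  and irreducible_X: "irreducible [:0, 1 :: bit:]"
  by (rule irreducible_linear_field_poly; simp)+

lemma irreducible_cases_reciprocal:
  "{P :: bit poly. irreducible P} = SRI \<union> NSRI \<union> {[:1, 1:], [:0, 1:]}"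
  using irreducible_X_plus_1 irreducible_X by (auto simp: SRI_def NSRI_def)

lemma SRI_even_degree: "P \<in> SRI \<Longrightarrow> even (degree P)"
  using self_reciprocal_odd_degree irreducible_dvd_irreducible irreducible_X_plus_1
  by (auto simp: SRI_def)

lemma NSRI_coeff_0: "P \<in> NSRI \<Longrightarrow> coeff P 0 = 1"
  using irreducible_coeff_0 by (auto simp: NSRI_def)

section \<open>Divisibility in the monoid \<open>palin\<close>\<close>

definition palin :: "bit poly set" where
  "palin = {F. self_reciprocal F \<and> F \<noteq> 0 \<and> even (degree F)}"

lemma palin_1: "1 \<in> palin"
  by (simp add: palin_def self_reciprocal_1)

lemma palin_mult: "F \<in> palin \<Longrightarrow> G \<in> palin \<Longrightarrow> F * G \<in> palin"
  by (simp add: palin_def self_reciprocal_mult degree_mult_eq)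

lemma palin_power: "F \<in> palin \<Longrightarrow> F ^ k \<in> palin"
  by (induction k) (auto simp: palin_1 palin_mult)

lemma palin_cancel: "F \<in> palin \<Longrightarrow> F * G \<in> palin \<Longrightarrow> G \<in> palin"
  using self_reciprocal_cancel[of F G] by (auto simp: palin_def degree_mult_eq)

lemma palin_SRI: "P \<in> SRI \<Longrightarrow> P \<in> palin"
  using SRI_even_degree by (auto simp: palin_def SRI_def)

lemma palin_NSRI: "P \<in> NSRI \<Longrightarrow> P * reflect_poly P \<in> palin"
  using NSRI_coeff_0[of P]
  by (cases "P = 0") (auto simp: palin_def self_reciprocal_def reflect_poly_mult degree_mult_eq mult.commute)

lemma palin_X_plus_1_square: "[:1, 1:]\<^sup>2 \<in> palin"
  by (simp add: palin_def self_reciprocal_power self_reciprocal_X_plus_1 degree_power_eq)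

text \<open>The cofactor of \<open>x + 1\<close> in a member of \<open>palin\<close> is
  self-reciprocal of odd degree, hence divisible by \<open>x + 1\<close> once more.\<close>

lemma X_plus_1_square_dvd_palin:
  assumes "F \<in> palin" "[:1, 1:] dvd F"
  shows "[:1, 1:]\<^sup>2 dvd F"
proof -
  obtain H where H: "F = [:1, 1:] * H" using assms(2) by (elim dvdE)
  have "H \<noteq> 0" using assms(1) H by (auto simp: palin_def)
  then have "degree F = Suc (degree H)" unfolding H by (subst degree_mult_eq) auto
  then have "odd (degree H)" using assms(1) by (auto simp: palin_def)
  moreover have "self_reciprocal H"
    by (rule self_reciprocal_cancel[OF self_reciprocal_X_plus_1])
      (use assms(1) H in \<open>auto simp: palin_def simp del: mult_pCons_left\<close>)
  ultimately have "[:1, 1:] dvd H" by (intro self_reciprocal_odd_degree)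
  then show ?thesis unfolding H power2_eq_square by (rule mult_dvd_mono[OF dvd_refl])
qed

text \<open>The exponent rounds \<open>k\<close> up to an even number. For odd \<open>k\<close>, the
  power with exponent \<open>k - 1\<close> is split off within \<open>palin\<close>, and the
  remaining factor \<open>x + 1\<close> brings a second one.\<close>

lemma X_plus_1_power_dvd_palin:
  assumes "F \<in> palin" "[:1, 1:] ^ k dvd F"
  shows "([:1, 1:]\<^sup>2) ^ ((k + 1) div 2) dvd F"
proof (cases "even k")
  case True
  then show ?thesis using assms(2) by (simp flip: power_mult)
next
  case False
  then obtain j where j: "k = 2 * j + 1" by (elim oddE)
  then have "([:1, 1:]\<^sup>2) ^ j * [:1, 1:] dvd F" using assms(2)
    by (simp only: power_add power_mult power_one_right)
  then obtain G where G: "F = (([:1, 1:]\<^sup>2) ^ j * [:1, 1:]) * G" by (elim dvdE)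
  then have F: "F = ([:1, 1:]\<^sup>2) ^ j * ([:1, 1:] * G)" by (simp only: mult.assoc)
  then have "[:1, 1:] * G \<in> palin"
    using palin_cancel assms(1) palin_power[OF palin_X_plus_1_square] by metis
  then have "[:1, 1:]\<^sup>2 dvd [:1, 1:] * G" by (rule X_plus_1_square_dvd_palin) (rule dvd_triv_left)
  then have "([:1, 1:]\<^sup>2) ^ j * [:1, 1:]\<^sup>2 dvd F" unfolding F by (rule mult_dvd_mono[OF dvd_refl])
  then show ?thesis using j by (simp add: mult.commute)
qed

text \<open>Reflecting \<open>F\<close> shows that the \<open>k\<close>-th power of
  \<open>reflect_poly P\<close> divides it too; as a power of a different irreducible, it must
  divide the cofactor of \<open>P ^ k\<close>.\<close>

lemma NSRI_power_dvd_palin: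
  assumes "P \<in> NSRI" "F \<in> palin" "P ^ k dvd F"
  shows "(P * reflect_poly P) ^ k dvd F"
proof -
  have P: "irreducible P" "irreducible (reflect_poly P)" "P \<noteq> reflect_poly P"
    using assms(1) NSRI_coeff_0 irreducible_reflect_poly by (auto simp: NSRI_def self_reciprocal_def)
  obtain G where G: "F = P ^ k * G" using assms(3) by (elim dvdE)
  have "F = reflect_poly F" using assms(2) by (simp add: palin_def self_reciprocal_def)
  also have "\<dots> = reflect_poly P ^ k * reflect_poly G" using G by (simp add: reflect_poly_mult reflect_poly_power)
  finally have "reflect_poly P ^ k dvd P ^ k * G" using G by (metis dvd_triv_left)
  then have "reflect_poly P ^ k dvd G" using irreducible_power_dvd_mult_iff P by metis
  then show ?thesis unfolding G power_mult_distrib by (rule mult_dvd_mono[OF dvd_refl])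
qed

text \<open>For \<open>P\<close> other than \<open>x\<close>, this is the least member of
  \<open>palin\<close> under divisibility that \<open>P ^ k\<close> divides, written as a power of
  the prime of \<open>palin\<close> lying over \<open>P\<close>.\<close>

definition palin_hull :: "bit poly \<Rightarrow> nat \<Rightarrow> bit poly" where
  "palin_hull P k = (if P = [:1, 1:] then ([:1, 1:]\<^sup>2) ^ ((k + 1) div 2)
     else if self_reciprocal P then P ^ k else (P * reflect_poly P) ^ k)"

lemma palin_hull:
  assumes "irreducible P" "P \<noteq> [:0, 1:]"
  shows "palin_hull P k \<in> palin" "F \<in> palin \<Longrightarrow> P ^ k dvd F \<longleftrightarrow> palin_hull P k dvd F"
proof -
  consider "P = [:1, 1:]" | "P \<in> SRI" | "P \<in> NSRI"
    using assms irreducible_cases_reciprocal by blast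
  note cases = this
  show "palin_hull P k \<in> palin"
    using assms palin_power palin_X_plus_1_square palin_SRI palin_NSRI
    by (auto simp: palin_hull_def SRI_def NSRI_def)
  have *: "P ^ k dvd palin_hull P k"
  proof -
    have "[:1, 1 :: bit:] ^ k dvd [:1, 1:] ^ (2 * ((k + 1) div 2))"
      by (rule le_imp_power_dvd) auto
    then show ?thesis by (auto simp: palin_hull_def power_mult power_mult_distrib)
  qed
  assume F: "F \<in> palin"
  show "P ^ k dvd F \<longleftrightarrow> palin_hull P k dvd F"
  proof
    assume "palin_hull P k dvd F" then show "P ^ k dvd F" using * dvd_trans by blast
  next
    assume "P ^ k dvd F"
    then show "palin_hull P k dvd F"
      using cases X_plus_1_power_dvd_palin[OF F] NSRI_power_dvd_palin[OF _ F]
      by cases (auto simp: palin_hull_def NSRI_def SRI_def)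
  qed
qed

section \<open>Logarithmic derivatives\<close>

definition SRI_sum :: "(bit poly \<Rightarrow> int) \<Rightarrow> nat \<Rightarrow> int" where
  "SRI_sum w m = (\<Sum>(P, k) | P \<in> SRI \<and> 1 \<le> k \<and> k * degree P = m. int (degree P) * w P ^ k)"

text \<open>Here \<open>m\<close> is half the degree of the power at which the weight is taken. Both
  members of a reciprocal pair occur, and their two factors \<open>degree P\<close> add up to the
  degree of the product.\<close>

definition NSRI_sum :: "(bit poly \<Rightarrow> int) \<Rightarrow> nat \<Rightarrow> int" where
  "NSRI_sum w m = (\<Sum>(P, k) | P \<in> NSRI \<and> 1 \<le> k \<and> k * degree P = m.
     int (degree P) * w (P * reflect_poly P) ^ k)"

lemma irreducible_nonzero: "irreducible P \<Longrightarrow> P \<noteq> 0"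
  by (simp add: irreducible_def)

lemma finite_irreducible_powers:
  "finite {(P :: bit poly, k). irreducible P \<and> 1 \<le> k \<and> k * degree P = m}"
proof (rule finite_subset)
  show "{(P :: bit poly, k). irreducible P \<and> 1 \<le> k \<and> k * degree P = m} \<subseteq> {P. degree P \<le> m} \<times> {..m}"
    using irreducible_degree_pos by (auto simp: Suc_le_eq)
  show "finite ({P :: bit poly. degree P \<le> m} \<times> {..m})"
    by (intro finite_cartesian_product finite_degree_le) simp
qed

lemma finite_SRI_powers: "finite {(P, k). P \<in> SRI \<and> 1 \<le> k \<and> k * degree P = m}"
  by (rule finite_subset[OF _ finite_irreducible_powers[of m]]) (auto simp: SRI_def)

lemma finite_NSRI_powers: "finite {(P, k). P \<in> NSRI \<and> 1 \<le> k \<and> k * degree P = m}"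
  by (rule finite_subset[OF _ finite_irreducible_powers[of m]]) (auto simp: NSRI_def)

lemma SRI_NSRI_D: "P \<in> SRI \<Longrightarrow> P \<noteq> [:1, 1:]" "P \<in> SRI \<Longrightarrow> P \<noteq> [:0, 1:]"
  "P \<in> NSRI \<Longrightarrow> P \<noteq> [:1, 1:]" "P \<in> NSRI \<Longrightarrow> P \<noteq> [:0, 1:]"
  "P \<in> SRI \<Longrightarrow> self_reciprocal P" "P \<in> NSRI \<Longrightarrow> \<not> self_reciprocal P"
  using self_reciprocal_X_plus_1 not_self_reciprocal_X by (auto simp: SRI_def NSRI_def)

lemma linear_notin_SRI_NSRI: "[:1, 1:] \<notin> SRI" "[:0, 1:] \<notin> SRI" "[:1, 1:] \<notin> NSRI" "[:0, 1:] \<notin> NSRI"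
  using SRI_NSRI_D by blast+

lemma NSRI_nonzero: "P \<in> NSRI \<Longrightarrow> P \<noteq> 0" and SRI_nonzero: "P \<in> SRI \<Longrightarrow> P \<noteq> 0"
  by (auto simp: SRI_def NSRI_def)

text \<open>The Euler product is applied with \<open>P ^ k\<close> as its own least multiple. Being
  linear, \<open>x + 1\<close> and \<open>x\<close> contribute to degree \<open>n\<close> with the
  single exponent \<open>n\<close>.\<close>

lemma all_poly_log_deriv:
  fixes w :: "bit poly \<Rightarrow> int"
  assumes wmult: "\<And>F G. w (F * G) = w F * w G" and w1: "w 1 = 1"
  defines "c \<equiv> \<lambda>m. \<Sum>F | F \<noteq> 0 \<and> degree F = m. w F"
  obtains p where "\<And>n. int n * c n = (\<Sum>m=1..n. p m * c (n - m))"
    and "\<And>n. 1 \<le> n \<Longrightarrow> p n = (\<Sum>(P, k) | P \<in> SRI \<and> 1 \<le> k \<and> k * degree P = n. int (degree P) * w P ^ k)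
      + (\<Sum>(P, k) | P \<in> NSRI \<and> 1 \<le> k \<and> k * degree P = n. int (degree P) * w P ^ k)
      + w [:1, 1:] ^ n + w [:0, 1:] ^ n"
proof
  define p where "p = (\<lambda>m. \<Sum>(P, k) | P \<in> {P. irreducible P} \<and> 1 \<le> k \<and> degree (P ^ k) = m. int (degree P) * w (P ^ k))"
  have wpow: "w (P ^ k) = w P ^ k" for P k by (induction k) (auto simp: wmult w1)
  show "int n * c n = (\<Sum>m=1..n. p m * c (n - m))" for n
  proof -
    have c: "c = (\<lambda>m. \<Sum>F | F \<in> {F. F \<noteq> 0} \<and> degree F = m. w F)" by (simp add: c_def)
    show ?thesis
      unfolding c p_def
      by (rule euler_product_log_deriv) (simp_all add: wmult finite_degree_eq irreducible_nonzero)
  qed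
  fix n :: nat assume n: "1 \<le> n"
  let ?h = "\<lambda>(P, k). int (degree P) * w P ^ k"
  let ?S = "{(P, k). P \<in> SRI \<and> 1 \<le> k \<and> k * degree P = n}"
  let ?N = "{(P, k). P \<in> NSRI \<and> 1 \<le> k \<and> k * degree P = n}"
  let ?L = "{([:1, 1:] :: bit poly, n), ([:0, 1:], n)}"
  have "p n = (\<Sum>z | fst z \<in> {P. irreducible P} \<and> 1 \<le> snd z \<and> snd z * degree (fst z) = n. ?h z)"
    unfolding p_def
    by (intro sum.cong) (auto simp: wpow degree_power_eq irreducible_nonzero)
  also have "{z :: bit poly \<times> nat. fst z \<in> {P. irreducible P} \<and> 1 \<le> snd z \<and> snd z * degree (fst z) = n}
      = (?S \<union> ?N) \<union> ?L"
    unfolding irreducible_cases_reciprocal using n by (auto simp: case_prod_unfold)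
  also have "sum ?h ((?S \<union> ?N) \<union> ?L) = sum ?h (?S \<union> ?N) + sum ?h ?L"
    by (rule sum.union_disjoint) (use finite_SRI_powers finite_NSRI_powers in \<open>auto simp: linear_notin_SRI_NSRI\<close>)
  also have "sum ?h (?S \<union> ?N) = sum ?h ?S + sum ?h ?N"
    by (rule sum.union_disjoint[OF finite_SRI_powers finite_NSRI_powers]) (auto simp: SRI_def NSRI_def)
  finally show "p n = sum ?h ?S + sum ?h ?N + w [:1, 1:] ^ n + w [:0, 1:] ^ n" by simp
qed

lemma palin_log_deriv:
  fixes w :: "bit poly \<Rightarrow> int"
  assumes wmult: "\<And>F G. F \<in> palin \<Longrightarrow> G \<in> palin \<Longrightarrow> w (F * G) = w F * w G" and w1: "w 1 = 1"
  defines "c \<equiv> \<lambda>m. \<Sum>F | F \<in> palin \<and> degree F = m. w F"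
  obtains p where "\<And>n. int n * c n = (\<Sum>m=1..n. p m * c (n - m))"
    and "\<And>n. 1 \<le> n \<Longrightarrow> p (2 * n) = SRI_sum w (2 * n) + NSRI_sum w n + 2 * w ([:1, 1:]\<^sup>2) ^ n"
proof
  let ?I = "{P :: bit poly. irreducible P \<and> P \<noteq> [:0, 1:]}"
  define p where "p = (\<lambda>m. \<Sum>(P, k) | P \<in> ?I \<and> 1 \<le> k \<and> degree (palin_hull P k) = m.
    int (degree P) * w (palin_hull P k))"
  have wpow: "w (P ^ k) = w P ^ k" if "P \<in> palin" for P k
    by (induction k) (auto simp: wmult w1 that palin_power)
  \<comment> \<open>Members of \<open>palin\<close> have constant coefficient 1, so \<open>x\<close>
    divides none of them and \<open>?I\<close> omits it.\<close>
  have X: "\<not> [:0, 1:] dvd F" if "F \<in> palin" for F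
    using that self_reciprocal_coeff_0[of F] poly_0_coeff_0[of F]
    by (auto simp: palin_def simp flip: poly_eq_0_iff_dvd)
  show "int n * c n = (\<Sum>m=1..n. p m * c (n - m))" for n
    unfolding c_def p_def
  proof (rule euler_product_log_deriv)
    show "0 \<notin> palin" by (simp add: palin_def)
    show "F * G \<in> palin" if "F \<in> palin" "G \<in> palin" for F G by (rule palin_mult) fact+
    show "G \<in> palin" if "F \<in> palin" "F * G \<in> palin" for F G by (rule palin_cancel) fact+
    show "w (F * G) = w F * w G" if "F \<in> palin" "G \<in> palin" for F G by (rule wmult) fact+
    show "finite {F \<in> palin. degree F = m}" for m by (rule finite_degree_eq)
    show "irreducible P" if "P \<in> ?I" for P using that by simp
    show "palin_hull P k \<in> palin" if "P \<in> ?I" "1 \<le> k" for P k using that palin_hull(1) by simp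
    show "P ^ k dvd F \<longleftrightarrow> palin_hull P k dvd F" if "P \<in> ?I" "1 \<le> k" "F \<in> palin" for P k F
      using that palin_hull(2) by simp
    show "\<not> P dvd F" if "irreducible P" "P \<notin> ?I" "F \<in> palin" for P F using that X by auto
  qed
  fix n :: nat assume n: "1 \<le> n"
  let ?h = "\<lambda>z. int (degree (fst z)) * w (palin_hull (fst z) (snd z))"
  let ?S = "{(P, k). P \<in> SRI \<and> 1 \<le> k \<and> k * degree P = 2 * n}"
  let ?N = "{(P, k). P \<in> NSRI \<and> 1 \<le> k \<and> k * degree P = n}"
  \<comment> \<open>The exponents \<open>2 * n - 1\<close> and \<open>2 * n\<close> of
    \<open>x + 1\<close> have the same hull, the \<open>n\<close>-th power of its square. This is
    the source of the factor 2 in the coefficient.\<close>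
  let ?L = "{([:1, 1:] :: bit poly, 2 * n - 1), ([:1, 1:], 2 * n)}"
  have hull: "palin_hull P k = P ^ k" if "P \<in> SRI" for P k
    using SRI_NSRI_D that by (simp add: palin_hull_def)
  have hull': "palin_hull P k = (P * reflect_poly P) ^ k" if "P \<in> NSRI" for P k
    using SRI_NSRI_D that by (simp add: palin_hull_def)
  have hull'': "palin_hull [:1, 1:] k = ([:1, 1:]\<^sup>2) ^ ((k + 1) div 2)" for k
    by (simp add: palin_hull_def)
  have deg: "degree (palin_hull P k) = k * degree P" if "P \<in> SRI" for P k
    using SRI_nonzero that by (simp add: hull degree_power_eq)
  have deg': "degree (palin_hull P k) = 2 * (k * degree P)" if "P \<in> NSRI" for P k
  proof -
    have "P \<noteq> 0" "reflect_poly P \<noteq> 0" using NSRI_nonzero that by auto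
    then show ?thesis
      using NSRI_coeff_0[OF that] by (simp add: hull'[OF that] degree_power_eq degree_mult_eq)
  qed
  have deg'': "degree (palin_hull [:1, 1:] k) = 2 * ((k + 1) div 2)" for k
    by (simp add: palin_hull_def degree_power_eq flip: power_mult)
  have I: "?I = SRI \<union> NSRI \<union> {[:1, 1:]}"
    using self_reciprocal_X_plus_1 not_self_reciprocal_X irreducible_X_plus_1
    by (auto simp: SRI_def NSRI_def)
  have "p (2 * n) = (\<Sum>z | fst z \<in> ?I \<and> 1 \<le> snd z \<and> degree (palin_hull (fst z) (snd z)) = 2 * n. ?h z)"
    unfolding p_def by (intro sum.cong) auto
  also have "{z. fst z \<in> ?I \<and> 1 \<le> snd z \<and> degree (palin_hull (fst z) (snd z)) = 2 * n} = (?S \<union> ?N) \<union> ?L"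
    (is "?A = _")
  proof (intro equalityI subsetI)
    fix z assume "z \<in> ?A"
    then obtain P k where z: "z = (P, k)" "P \<in> ?I" "1 \<le> k" "degree (palin_hull P k) = 2 * n"
      by (cases z) auto
    have "P \<in> SRI \<or> P \<in> NSRI \<or> P = [:1, 1:]" using z(2) unfolding I by auto
    then show "z \<in> (?S \<union> ?N) \<union> ?L"
      using z(1,3,4) deg[of P k] deg'[of P k] deg''[of k] by auto
  next
    fix z assume "z \<in> (?S \<union> ?N) \<union> ?L"
    then show "z \<in> ?A" unfolding I using n deg deg' deg'' by auto
  qed
  also have "sum ?h ((?S \<union> ?N) \<union> ?L) = sum ?h (?S \<union> ?N) + sum ?h ?L"
    by (rule sum.union_disjoint) (use finite_SRI_powers finite_NSRI_powers in \<open>auto simp: linear_notin_SRI_NSRI\<close>)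
  also have "sum ?h (?S \<union> ?N) = sum ?h ?S + sum ?h ?N"
    by (rule sum.union_disjoint[OF finite_SRI_powers finite_NSRI_powers]) (auto simp: SRI_def NSRI_def)
  also have "sum ?h ?S = SRI_sum w (2 * n)"
    unfolding SRI_sum_def by (intro sum.cong) (auto simp: hull wpow palin_SRI)
  also have "sum ?h ?N = NSRI_sum w n"
    unfolding NSRI_sum_def by (intro sum.cong) (auto simp: hull' wpow palin_NSRI)
  also have "sum ?h ?L = 2 * w ([:1, 1:]\<^sup>2) ^ n"
    using n by (simp add: hull'' wpow palin_X_plus_1_square)
  finally show "p (2 * n) = SRI_sum w (2 * n) + NSRI_sum w n + 2 * w ([:1, 1:]\<^sup>2) ^ n" .
qed

section \<open>Weighted counts by degree\<close>

lemma card_degree_eq: "card {F :: bit poly. F \<noteq> 0 \<and> degree F = m} = 2 ^ m"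
proof -
  have "bij_betw (\<lambda>B. set_poly (insert m B)) (Pow {..<m}) {F. F \<noteq> 0 \<and> degree F = m}"
  proof (rule bij_betw_byWitness[where f' = "\<lambda>F. {i. i < m \<and> coeff F i = 1}"])
    show "\<forall>B\<in>Pow {..<m}. {i. i < m \<and> coeff (set_poly (insert m B)) i = 1} = B"
      by (auto simp: coeff_set_poly finite_subset)
    show "\<forall>F\<in>{F. F \<noteq> 0 \<and> degree F = m}. set_poly (insert m {i. i < m \<and> coeff F i = 1}) = F"
    proof safe
      fix F :: "bit poly" assume "F \<noteq> 0" "m = degree F"
      then have "insert m {i. i < m \<and> coeff F i = 1} = {i. coeff F i = 1}"
        using le_degree[of F] bit_poly_lead_coeff[of F] by (auto simp: le_less)
      then show "set_poly (insert (degree F) {i. i < degree F \<and> coeff F i = 1}) = F"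
        using \<open>m = degree F\<close> set_poly_support by metis
    qed
    show "(\<lambda>B. set_poly (insert m B)) ` Pow {..<m} \<subseteq> {F. F \<noteq> 0 \<and> degree F = m}"
    proof safe
      fix B assume "B \<subseteq> {..<m}"
      then have B: "finite (insert m B)" "insert m B \<subseteq> {..m}" by (auto intro: finite_subset)
      then show "degree (set_poly (insert m B)) = m" by (intro degree_set_poly) auto
      have "coeff (set_poly (insert m B)) m = 1" using B(1) by (simp add: coeff_set_poly)
      moreover assume "set_poly (insert m B) = 0"
      ultimately show False by simp
    qed
  qed auto
  then have "card {F :: bit poly. F \<noteq> 0 \<and> degree F = m} = card (Pow {..<m})"
    by (simp add: bij_betw_same_card)
  then show ?thesis by (simp add: card_Pow)
qed

lemma self_reciprocalI:
  assumes "\<And>i. i \<le> degree F \<Longrightarrow> coeff F (degree F - i) = coeff F i"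
  shows "self_reciprocal F"
  using assms by (auto simp: self_reciprocal_def poly_eq_iff coeff_reflect_poly coeff_eq_0)

text \<open>The coefficients at the exponents 1 to \<open>m\<close> are free and determine the
  others by symmetry, the two outermost being 1.\<close>

lemma card_palin: "card {F. F \<in> palin \<and> degree F = 2 * m} = 2 ^ m"
proof -
  \<comment> \<open>The full exponent set: both ends, the chosen exponents and their mirror images.
    The middle exponent \<open>m\<close> is its own image.\<close>
  define h where "h = (\<lambda>B. {0, 2 * m} \<union> B \<union> (\<lambda>i. 2 * m - i) ` B)"
  have h: "finite (h B)" "h B \<subseteq> {..2 * m}" "2 * m \<in> h B" "\<And>i. i \<in> {1..m} \<Longrightarrow> i \<in> h B \<longleftrightarrow> i \<in> B"
    if "B \<subseteq> {1..m}" for B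
  proof -
    show "finite (h B)" "h B \<subseteq> {..2 * m}" "2 * m \<in> h B"
      using that finite_subset[OF that] by (auto simp: h_def subset_iff)
    fix i assume i: "i \<in> {1..m}"
    have "i \<in> B" if "i \<in> (\<lambda>i. 2 * m - i) ` B"
    proof -
      from that obtain j where j: "i = 2 * m - j" "j \<in> B" by blast
      with i \<open>B \<subseteq> {1..m}\<close> have "j = i" by force
      with j show ?thesis by simp
    qed
    then show "i \<in> h B \<longleftrightarrow> i \<in> B" using i by (auto simp: h_def)
  qed
  have hsym: "2 * m - i \<in> h B \<longleftrightarrow> i \<in> h B" if "B \<subseteq> {1..m}" "i \<le> 2 * m" for B i
  proof -
    have *: "2 * m - i \<in> h B" if "i \<in> h B" "i \<le> 2 * m" for i
      using that \<open>B \<subseteq> {1..m}\<close> by (force simp: h_def)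
    show ?thesis using *[of i] *[of "2 * m - i"] that by auto
  qed
  have "bij_betw (\<lambda>B. set_poly (h B)) (Pow {1..m}) {F. F \<in> palin \<and> degree F = 2 * m}"
  proof (rule bij_betw_byWitness[where f' = "\<lambda>F. {i\<in>{1..m}. coeff F i = 1}"])
    show "\<forall>B\<in>Pow {1..m}. {i\<in>{1..m}. coeff (set_poly (h B)) i = 1} = B"
    proof
      fix B assume "B \<in> Pow {1..m}"
      then show "{i\<in>{1..m}. coeff (set_poly (h B)) i = 1} = B"
        using h[of B] by (auto simp: coeff_set_poly)
    qed
    show "\<forall>F\<in>{F. F \<in> palin \<and> degree F = 2 * m}. set_poly (h {i\<in>{1..m}. coeff F i = 1}) = F"
    proof safe
      fix F :: "bit poly" assume F: "F \<in> palin" "degree F = 2 * m"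
      have sym: "coeff F (2 * m - i) = coeff F i" if "i \<le> 2 * m" for i
        using self_reciprocal_coeff[of F i] F that by (simp add: palin_def)
      have "coeff F 0 = 1" "coeff F (2 * m) = 1"
        using F self_reciprocal_coeff_0[of F] bit_poly_lead_coeff[of F] by (auto simp: palin_def)
      note ends = this
      have "h {i\<in>{1..m}. coeff F i = 1} = {i. coeff F i = 1}"
      proof (intro equalityI subsetI)
        fix i assume "i \<in> h {i\<in>{1..m}. coeff F i = 1}"
        then consider "i = 0" | "i = 2 * m" | "coeff F i = 1"
          | j where "j \<in> {1..m}" "coeff F j = 1" "i = 2 * m - j"
          by (auto simp: h_def)
        then show "i \<in> {i. coeff F i = 1}" using ends sym by cases auto
      next
        fix i assume "i \<in> {i. coeff F i = 1}"
        then have i: "coeff F i = 1" by simp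
        with le_degree[of F i] F have le: "i \<le> 2 * m" by simp
        then consider "i = 0" | "i \<in> {1..m}" | "i = 2 * m" | "m < i" "i < 2 * m" by fastforce
        then show "i \<in> h {i\<in>{1..m}. coeff F i = 1}"
        proof cases
          case 4
          then have "i = 2 * m - (2 * m - i)" "2 * m - i \<in> {i\<in>{1..m}. coeff F i = 1}"
            using i sym[OF le] by auto
          then have "i \<in> (\<lambda>i. 2 * m - i) ` {i\<in>{1..m}. coeff F i = 1}" by (rule image_eqI)
          then show ?thesis by (simp add: h_def)
        qed (use i in \<open>auto simp: h_def\<close>)
      qed
      then show "set_poly (h {i\<in>{1..m}. coeff F i = 1}) = F"
        using set_poly_support by metis
    qed
    show "(\<lambda>B. set_poly (h B)) ` Pow {1..m} \<subseteq> {F. F \<in> palin \<and> degree F = 2 * m}"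
    proof safe
      fix B assume B: "B \<subseteq> {1..m}"
      then show deg: "degree (set_poly (h B)) = 2 * m" using h by (intro degree_set_poly)
      have "coeff (set_poly (h B)) (2 * m) = 1" using h[OF B] by (simp add: coeff_set_poly)
      then have "set_poly (h B) \<noteq> 0" by auto
      moreover have "self_reciprocal (set_poly (h B))"
        by (rule self_reciprocalI) (use h(1)[OF B] hsym[OF B] in \<open>simp add: deg coeff_set_poly\<close>)
      ultimately show "set_poly (h B) \<in> palin" using deg by (simp add: palin_def)
    qed
  qed blast
  then have "card {F. F \<in> palin \<and> degree F = 2 * m} = card (Pow {1..m})"
    by (simp add: bij_betw_same_card)
  then show ?thesis by (simp add: card_Pow)
qed

lemma palin_odd_degree: "odd m \<Longrightarrow> {F. F \<in> palin \<and> degree F = m} = {}"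
  by (auto simp: palin_def)

section \<open>Sums of signs over polynomials of a given degree\<close>

lemma sum_sign_reversing_involution:
  fixes w :: "'a \<Rightarrow> int"
  assumes "\<And>x. x \<in> S \<Longrightarrow> g x \<in> S" "\<And>x. x \<in> S \<Longrightarrow> g (g x) = x" "\<And>x. x \<in> S \<Longrightarrow> w (g x) = - w x"
  shows "sum w S = 0"
proof -
  have "sum w S = (\<Sum>x\<in>S. - w x)"
    by (rule sum.reindex_bij_witness[of _ g g]) (use assms in auto)
  then show ?thesis by (simp add: sum_negf)
qed

text \<open>For constant coefficient 1, the coefficient of \<open>x\<close> is the sum of the
  inverses of the roots. It is additive under products, so the sign is multiplicative.\<close>

definition coeff1_sign :: "bit poly \<Rightarrow> int" where
  "coeff1_sign F = (if coeff F 1 = 0 then 1 else -1)"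

lemma coeff1_sign_1: "coeff1_sign 1 = 1"
  by (simp add: coeff1_sign_def)

lemma coeff1_sign_square: "coeff1_sign F * coeff1_sign F = 1"
  by (simp add: coeff1_sign_def)

lemma coeff_mult_1:
  fixes F G :: "'a :: comm_semiring_0 poly"
  shows "coeff (F * G) 1 = coeff F 0 * coeff G 1 + coeff F 1 * coeff G 0"
  by (simp add: coeff_mult)

lemma coeff1_sign_mult:
  assumes "coeff F 0 = 1" "coeff G 0 = 1"
  shows "coeff1_sign (F * G) = coeff1_sign F * coeff1_sign G"
proof -
  have "coeff (F * G) 1 = coeff F 0 * coeff G 1 + coeff F 1 * coeff G 0"
    by (rule coeff_mult_1)
  then show ?thesis using assms by (cases "coeff F 1"; cases "coeff G 1") (auto simp: coeff1_sign_def)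
qed

text \<open>The value 0 at multiples of \<open>x\<close> makes the function multiplicative on all
  polynomials, as for a Dirichlet character. Elsewhere it is the sign of the sum of the roots and
  their inverses.\<close>

definition coeff1_sign2 :: "bit poly \<Rightarrow> int" where
  "coeff1_sign2 F = (if coeff F 0 = 0 then 0 else coeff1_sign F * coeff1_sign (reflect_poly F))"

lemma coeff1_sign2_mult: "coeff1_sign2 (F * G) = coeff1_sign2 F * coeff1_sign2 G"
proof (cases "coeff F 0 = 1 \<and> coeff G 0 = 1")
  case True
  then have "F \<noteq> 0" "G \<noteq> 0" by auto
  with True show ?thesis
    by (simp add: coeff1_sign2_def coeff_mult_0 reflect_poly_mult coeff1_sign_mult)
next
  case False
  then show ?thesis by (auto simp: coeff1_sign2_def coeff_mult_0)
qed

lemma palin_sign_sum: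
  assumes "1 \<le> m"
  shows "(\<Sum>F | F \<in> palin \<and> degree F = m. coeff1_sign F) = 0"
proof (cases "even m")
  case False
  then show ?thesis by (simp only: palin_odd_degree[OF False] sum.empty)
next
  case True
  then obtain k where k: "m = 2 * k" by (elim evenE)
  \<comment> \<open>Adding \<open>T\<close> flips the coefficient of \<open>x\<close> and keeps the
    symmetry. For \<open>m = 2\<close> the two exponents coincide, and since \<open>set_poly\<close>
    takes a set, \<open>T\<close> is then \<open>x\<close> rather than 0.\<close>
  define T where "T = set_poly {1, m - 1}"
  have T: "coeff T i = of_bool (i = 1 \<or> i = m - 1)" for i by (auto simp: T_def coeff_set_poly)
  show ?thesis
  proof (rule sum_sign_reversing_involution[of _ "\<lambda>F. F + T"])
    fix F assume "F \<in> {F. F \<in> palin \<and> degree F = m}"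
    then have F: "self_reciprocal F" "F \<noteq> 0" "degree F = m" by (auto simp: palin_def)
    have "degree T < degree F"
      using F(3) assms k by (intro degree_lessI) (auto simp: T)
    then have deg: "degree (F + T) = m" using F by (simp add: degree_add_eq_left)
    have "self_reciprocal (F + T)"
    proof (rule self_reciprocalI)
      fix i assume i: "i \<le> degree (F + T)"
      then have "m - i = 1 \<or> m - i = m - 1 \<longleftrightarrow> i = 1 \<or> i = m - 1" using assms deg by auto
      then show "coeff (F + T) (degree (F + T) - i) = coeff (F + T) i"
        using self_reciprocal_coeff[OF F(1), of i] i F(3) by (simp only: deg coeff_add T)
    qed
    moreover have "F + T \<noteq> 0" using deg assms by auto
    ultimately show "F + T \<in> {F. F \<in> palin \<and> degree F = m}" using deg k by (simp add: palin_def)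
    have "T + T = 0" by (rule poly_eqI) (simp only: coeff_add coeff_0 T, simp)
    then show "F + T + T = F" by (simp only: add.assoc add_0_right)
    have "coeff (F + T) 1 = coeff F 1 + 1" by (simp only: coeff_add T) simp
    then show "coeff1_sign (F + T) = - coeff1_sign F"
      by (cases "coeff F 1") (simp_all add: coeff1_sign_def)
  qed
qed

text \<open>Adding \<open>x\<close> flips the first sign. From degree 3 on, the coefficient below
  the leading one is not that of \<open>x\<close>, so the second sign is unchanged and the terms
  cancel in pairs.\<close>

lemma sign2_sum_ge_3:
  assumes "3 \<le> m"
  shows "(\<Sum>F | F \<noteq> 0 \<and> degree F = m. coeff1_sign2 F) = 0"
proof (rule sum_sign_reversing_involution[of _ "\<lambda>F. F + monom 1 1"])
  fix F :: "bit poly" assume "F \<in> {F. F \<noteq> 0 \<and> degree F = m}"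
  then have F: "F \<noteq> 0" "degree F = m" by auto
  have "degree (monom (1::bit) 1) < degree F" using F assms by (simp add: degree_monom_eq)
  then have deg: "degree (F + monom 1 1) = m" using F by (simp add: degree_add_eq_left)
  then show "F + monom 1 1 \<in> {F. F \<noteq> 0 \<and> degree F = m}" using assms by auto
  show "F + monom 1 1 + monom 1 1 = F" by (simp add: add.assoc add_monom)
  have "Suc 0 \<noteq> m - Suc 0" using assms by arith
  then have "coeff (reflect_poly (F + monom 1 1)) 1 = coeff (reflect_poly F) 1"
    using deg F(2) assms by (simp add: coeff_reflect_poly)
  moreover have "coeff (F + monom 1 1) 1 = coeff F 1 + 1" by (simp only: coeff_add) simp
  moreover have "coeff (F + monom 1 1) 0 = coeff F 0" by (simp only: coeff_add) simp
  ultimately show "coeff1_sign2 (F + monom 1 1) = - coeff1_sign2 F"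
    by (cases "coeff F 1") (simp_all add: coeff1_sign_def coeff1_sign2_def)
qed

text \<open>The sums in degrees 0, 1 and 2, found by enumeration, are the coefficients of the
  L-function of \<open>coeff1_sign2\<close>.\<close>

lemma sign2_sum_0: "(\<Sum>F | F \<noteq> 0 \<and> degree F = 0. coeff1_sign2 F) = 1"
proof -
  have "{F :: bit poly. F \<noteq> 0 \<and> degree F = 0} = {1}" using bit_poly_degree_0_iff by auto
  then show ?thesis by (simp add: coeff1_sign2_def coeff1_sign_def)
qed

lemma sign2_sum_1: "(\<Sum>F | F \<noteq> 0 \<and> degree F = 1. coeff1_sign2 F) = 1"
proof -
  have "{F :: bit poly. F \<noteq> 0 \<and> degree F = 1} = {[:0, 1:], [:1, 1:]}" (is "?L = ?R")
  proof
    show "?L \<subseteq> ?R"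
    proof
      fix F :: "bit poly" assume "F \<in> ?L"
      then have "F = [:coeff F 0, 1:]"
        using bit_poly_lead_coeff[of F] by (auto simp: poly_eq_iff coeff_pCons coeff_eq_0 split: nat.splits)
      then show "F \<in> ?R" by (cases "coeff F 0") auto
    qed
  qed auto
  then show ?thesis
    by (simp add: coeff1_sign2_def coeff1_sign_def coeff_reflect_poly)
qed

lemma sign2_sum_2: "(\<Sum>F | F \<noteq> 0 \<and> degree F = 2. coeff1_sign2 F) = 2"
proof -
  have "{F :: bit poly. F \<noteq> 0 \<and> degree F = 2}
      = {[:0, 0, 1:], [:1, 0, 1:], [:0, 1, 1:], [:1, 1, 1:]}" (is "?L = ?R")
  proof
    show "?L \<subseteq> ?R"
    proof
      fix F :: "bit poly" assume "F \<in> ?L"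
      then have "F = [:coeff F 0, coeff F 1, 1:]"
        using bit_poly_lead_coeff[of F]
        by (auto simp: poly_eq_iff coeff_pCons coeff_eq_0 numeral_2_eq_2 split: nat.splits)
      then show "F \<in> ?R" by (cases "coeff F 0"; cases "coeff F 1") auto
    qed
  qed auto
  then show ?thesis
    by (simp add: coeff1_sign2_def coeff1_sign_def coeff_reflect_poly)
qed

section \<open>Sums over irreducible polynomials\<close>

text \<open>The generating function of the counts is \<open>1 / (1 - 2 * T^2)\<close>, whose
  logarithmic derivative is explicit. The summand 2 comes from \<open>x + 1\<close>.\<close>

lemma palin_count_identity:
  assumes "1 \<le> n"
  shows "SRI_sum (\<lambda>_. 1) (2 * n) + NSRI_sum (\<lambda>_. 1) n + 2 = 2 ^ (n + 1)"
proof -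
  define c :: "nat \<Rightarrow> int" where "c = (\<lambda>m. \<Sum>F | F \<in> palin \<and> degree F = m. 1)"
  obtain p where rec: "\<And>n. int n * c n = (\<Sum>m=1..n. p m * c (n - m))"
    and p: "\<And>n. 1 \<le> n \<Longrightarrow> p (2 * n) = SRI_sum (\<lambda>_. 1) (2 * n) + NSRI_sum (\<lambda>_. 1) n + 2 * 1 ^ n"
    unfolding c_def by (rule palin_log_deriv[of "\<lambda>_. 1"]) auto
  have c_even: "c (2 * k) = 2 ^ k" for k unfolding c_def by (simp add: card_palin)
  have c_odd: "c k = 0" if "odd k" for k unfolding c_def palin_odd_degree[OF that] by simp
  have step: "c (k + 2) = 2 * c k" for k
  proof (cases "even k")
    case True
    then obtain l where "k = 2 * l" by (elim evenE)
    then show ?thesis using c_even[of l] c_even[of "l + 1"] by simp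
  qed (simp add: c_odd)
  obtain d where n: "n = Suc d" using assms by (cases n) auto
  \<comment> \<open>Twice the identity for degree \<open>2 * d\<close> is subtracted from the one
    for \<open>2 * d + 2\<close>. By \<open>step\<close> the common terms cancel, \<open>c 1\<close>
    is 0, and \<open>p (2 * n)\<close> remains.\<close>
  have "int (2 * n) * c (2 * n) = (\<Sum>m=1..2 * d + 2. p m * c (2 * d + 2 - m))"
    using rec[of "2 * n"] by (simp add: n)
  also have "\<dots> = (\<Sum>m=1..2 * d. p m * c (2 * d + 2 - m)) + p (2 * d + 1) * c 1 + p (2 * d + 2) * c 0"
    by simp
  also have "(\<Sum>m=1..2 * d. p m * c (2 * d + 2 - m)) = (\<Sum>m=1..2 * d. 2 * (p m * c (2 * d - m)))"
  proof (intro sum.cong refl)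
    fix m assume "m \<in> {1..2 * d}"
    then have "2 * d + 2 - m = (2 * d - m) + 2" by auto
    then show "p m * c (2 * d + 2 - m) = 2 * (p m * c (2 * d - m))" by (simp only: step)
  qed
  also have "\<dots> = 2 * (int (2 * d) * c (2 * d))" unfolding rec by (simp add: sum_distrib_left)
  finally have "p (2 * n) = 2 ^ (n + 1)"
    using c_even[of n] c_even[of d] c_even[of 0] c_odd[of 1] by (simp add: n algebra_simps)
  then show ?thesis using p[OF assms] by simp
qed

text \<open>The signed sums vanish in positive degree, so the generating function is 1 and its
  logarithmic derivative is 0.\<close>

lemma palin_sign_identity:
  assumes "1 \<le> n"
  shows "SRI_sum coeff1_sign (2 * n) + NSRI_sum coeff1_sign n + 2 = 0"
proof -
  define c where "c = (\<lambda>m. \<Sum>F | F \<in> palin \<and> degree F = m. coeff1_sign F)"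
  have mult: "coeff1_sign (F * G) = coeff1_sign F * coeff1_sign G" if "F \<in> palin" "G \<in> palin" for F G
    using that self_reciprocal_coeff_0 by (intro coeff1_sign_mult) (auto simp: palin_def)
  obtain p where rec: "\<And>n. int n * c n = (\<Sum>m=1..n. p m * c (n - m))"
    and p: "\<And>n. 1 \<le> n \<Longrightarrow> p (2 * n) = SRI_sum coeff1_sign (2 * n) + NSRI_sum coeff1_sign n
      + 2 * coeff1_sign ([:1, 1:]\<^sup>2) ^ n"
    unfolding c_def by (rule palin_log_deriv[of coeff1_sign]) (use mult coeff1_sign_1 in auto)
  have c: "c m = 0" if "1 \<le> m" for m unfolding c_def by (rule palin_sign_sum[OF that])
  have "{F. F \<in> palin \<and> degree F = 0} = {1}"
    using bit_poly_degree_0_iff palin_1 by (auto simp: palin_def)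
  then have c0: "c 0 = 1" by (simp add: c_def coeff1_sign_1)
  obtain d where d: "2 * n = Suc d" using assms by (cases "2 * n") auto
  have "0 = int (2 * n) * c (2 * n)" using c[of "2 * n"] assms by simp
  also have "\<dots> = (\<Sum>m=1..d. p m * c (Suc d - m)) + p (2 * n) * c 0"
    unfolding rec d by simp
  also have "(\<Sum>m=1..d. p m * c (Suc d - m)) = 0" using c by (intro sum.neutral) auto
  finally have "p (2 * n) = 0" using c0 by simp
  moreover have "coeff1_sign ([:1, 1:]\<^sup>2) = 1"
    by (simp add: power2_eq_square coeff1_sign_def)
  ultimately show ?thesis using p[OF assms] by simp
qed

text \<open>The generating function is \<open>1 / (1 - 2 * T)\<close>. The summand 2 comes from
  \<open>x\<close> and \<open>x + 1\<close>.\<close>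

lemma all_poly_count_identity:
  assumes "1 \<le> n"
  shows "SRI_sum (\<lambda>_. 1) n + NSRI_sum (\<lambda>_. 1) n + 2 = 2 ^ n"
proof -
  define c :: "nat \<Rightarrow> int" where "c = (\<lambda>m. \<Sum>F :: bit poly | F \<noteq> 0 \<and> degree F = m. 1)"
  obtain p where rec: "\<And>n. int n * c n = (\<Sum>m=1..n. p m * c (n - m))"
    and p: "\<And>n. 1 \<le> n \<Longrightarrow> p n = (\<Sum>(P, k) | P \<in> SRI \<and> 1 \<le> k \<and> k * degree P = n. int (degree P) * 1 ^ k)
      + (\<Sum>(P, k) | P \<in> NSRI \<and> 1 \<le> k \<and> k * degree P = n. int (degree P) * 1 ^ k) + 1 ^ n + 1 ^ n"
    unfolding c_def by (rule all_poly_log_deriv[of "\<lambda>_. 1"]) auto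
  have c: "c k = 2 ^ k" for k unfolding c_def by (simp add: card_degree_eq)
  obtain d where n: "n = Suc d" using assms by (cases n) auto
  have "int n * c n = (\<Sum>m=1..d. p m * c (Suc d - m)) + p n * c 0"
    unfolding rec n by simp
  also have "(\<Sum>m=1..d. p m * c (Suc d - m)) = (\<Sum>m=1..d. 2 * (p m * c (d - m)))"
    by (intro sum.cong refl) (simp add: c Suc_diff_le)
  also have "\<dots> = 2 * (int d * c d)" by (simp add: rec sum_distrib_left)
  finally have "p n = 2 ^ n" by (simp add: c n algebra_simps)
  then show ?thesis using p[OF assms] by (simp add: SRI_sum_def NSRI_sum_def)
qed

text \<open>This is the Kloosterman sum over the nonzero \<open>y\<close> in the field with \<open>2 ^ n\<close> elements of
  \<open>(-1) ^ Tr (y + 1 / y)\<close>: the sum over \<open>y\<close> is arranged by minimal polynomials. Its recurrence reflects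
  the L-function \<open>1 + T + 2 * T\<^sup>2\<close> of the character \<open>coeff1_sign2\<close>.\<close>

definition kloosterman :: "nat \<Rightarrow> int" where
  "kloosterman n = SRI_sum (\<lambda>_. 1) n + NSRI_sum coeff1_sign n + 1"

text \<open>For positive \<open>n\<close>, \<open>kloosterman n\<close> is a coefficient of the
  logarithmic derivative for \<open>coeff1_sign2\<close>: the two signs of a self-reciprocal
  irreducible agree and give weight 1, any other one except \<open>x\<close> has the sign of its
  product with its reciprocal, \<open>x + 1\<close> gives 1 and \<open>x\<close> gives 0.\<close>

lemma kloosterman_rec: "kloosterman 1 = 1" "kloosterman 2 = 3"
    "kloosterman (n + 3) = - kloosterman (n + 2) - 2 * kloosterman (n + 1)"
proof -
  define c where "c = (\<lambda>m. \<Sum>F | F \<noteq> 0 \<and> degree F = m. coeff1_sign2 F)"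
  have "coeff1_sign2 1 = 1" by (simp add: coeff1_sign2_def coeff1_sign_def)
  then obtain p where rec: "\<And>n. int n * c n = (\<Sum>m=1..n. p m * c (n - m))"
    and p: "\<And>n. 1 \<le> n \<Longrightarrow> p n = (\<Sum>(P, k) | P \<in> SRI \<and> 1 \<le> k \<and> k * degree P = n. int (degree P) * coeff1_sign2 P ^ k)
      + (\<Sum>(P, k) | P \<in> NSRI \<and> 1 \<le> k \<and> k * degree P = n. int (degree P) * coeff1_sign2 P ^ k)
      + coeff1_sign2 [:1, 1:] ^ n + coeff1_sign2 [:0, 1:] ^ n"
    unfolding c_def using all_poly_log_deriv[of coeff1_sign2] coeff1_sign2_mult by blast
  have X: "coeff1_sign2 [:0, 1:] = 0" "coeff1_sign2 [:1, 1:] = 1"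
    by (simp_all add: coeff1_sign2_def coeff1_sign_def coeff_reflect_poly)
  have SRI: "coeff1_sign2 P = 1" if "P \<in> SRI" for P
    using that self_reciprocal_coeff_0[of P] SRI_nonzero[OF that]
    by (auto simp: SRI_def coeff1_sign2_def self_reciprocal_def coeff1_sign_square)
  have NSRI: "coeff1_sign2 P = coeff1_sign (P * reflect_poly P)" if "P \<in> NSRI" for P
    using that NSRI_coeff_0[of P] NSRI_nonzero[OF that]
    by (simp add: coeff1_sign2_def coeff1_sign_mult)
  have K: "kloosterman n = p n" if "1 \<le> n" for n
  proof -
    have "p n = SRI_sum (\<lambda>_. 1) n + NSRI_sum coeff1_sign n + 1"
    proof -
      have "(\<Sum>(P, k) | P \<in> SRI \<and> 1 \<le> k \<and> k * degree P = n. int (degree P) * coeff1_sign2 P ^ k)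
          = SRI_sum (\<lambda>_. 1) n"
        unfolding SRI_sum_def by (intro sum.cong) (auto simp: SRI)
      moreover have "(\<Sum>(P, k) | P \<in> NSRI \<and> 1 \<le> k \<and> k * degree P = n. int (degree P) * coeff1_sign2 P ^ k)
          = NSRI_sum coeff1_sign n"
        unfolding NSRI_sum_def by (intro sum.cong) (auto simp: NSRI)
      ultimately show ?thesis using p[OF that] that X by simp
    qed
    then show ?thesis by (simp add: kloosterman_def)
  qed
  have c: "c 0 = 1" "c 1 = 1" "c 2 = 2"
    unfolding c_def by (rule sign2_sum_0 sign2_sum_1 sign2_sum_2)+
  have c': "c k = 0" if "3 \<le> k" for k
    unfolding c_def by (rule sign2_sum_ge_3[OF that])
  show 1: "kloosterman 1 = 1" using rec[of 1] c by (simp add: K)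
  show "kloosterman 2 = 3" using rec[of 2] c 1 by (simp add: K numeral_2_eq_2)
  \<comment> \<open>Since \<open>c\<close> vanishes from degree 3 on, only the last three terms of
    the convolution survive, with the factors 2, 1 and 1.\<close>
  have "0 = int (n + 3) * c (n + 3)" using c' by simp
  also have "\<dots> = (\<Sum>m=1..n. p m * c (n + 3 - m)) + p (n + 1) * c 2 + p (n + 2) * c 1 + p (n + 3) * c 0"
    unfolding rec by (simp add: numeral_3_eq_3 numeral_2_eq_2)
  also have "(\<Sum>m=1..n. p m * c (n + 3 - m)) = 0" using c' by (intro sum.neutral) auto
  finally show "kloosterman (n + 3) = - kloosterman (n + 2) - 2 * kloosterman (n + 1)"
    by (simp add: c c(2)[unfolded One_nat_def] K)
qed

text \<open>The characteristic polynomial \<open>z^2 + z + 2\<close> has roots of absolute value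
  \<open>sqrt 2\<close> and arguments plus and minus \<open>pi - \<theta>\<close>. The closed form
  is minus the sum of their \<open>n\<close>-th powers.\<close>

lemma kloosterman_cos:
  defines "\<theta> \<equiv> arccos (1 / (2 * sqrt 2))"
  shows "1 \<le> n \<Longrightarrow> real_of_int (kloosterman n) = - ((-1) ^ n * (2 * sqrt 2 ^ n * cos (real n * \<theta>)))"
proof (induction n rule: less_induct)
  case (less n)
  have "1 \<le> sqrt 2" by simp
  then have "1 \<le> 2 * sqrt 2" by linarith
  then have "1 / (2 * sqrt 2) \<le> 1" by (subst divide_le_eq_1_pos) auto
  then have cos: "cos \<theta> = 1 / (2 * sqrt 2)" unfolding \<theta>_def by (intro cos_arccos) (auto intro: order.trans[of _ 0])
  consider "n = 1" | "n = 2" | k where "n = k + 3"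
    using less.prems by (metis One_nat_def Suc_1 add.commute le_Suc_ex not_less_eq_eq numeral_3_eq_3 le_antisym)
  then show ?case
  proof cases
    case 1
    then show ?thesis using kloosterman_rec(1) cos by simp
  next
    case 2
    then show ?thesis using kloosterman_rec(2) cos by (simp add: cos_double_cos power_divide power_mult_distrib)
  next
    case 3
    \<comment> \<open>The \<open>k\<close>-th power of minus \<open>sqrt 2\<close>, a factor common
      to the three consecutive values.\<close>
    define q where "q = (-1) ^ k * sqrt 2 ^ k"
    define x where "x = real (k + 2) * \<theta>"
    \<comment> \<open>Since \<open>2 * cos \<theta>\<close> is the inverse of \<open>sqrt 2\<close>,
      this three-term relation turns into the recurrence of \<open>kloosterman\<close> after
      scaling.\<close>
    have "cos (x + \<theta>) + cos (x - \<theta>) = 2 * cos \<theta> * cos x"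
      by (simp add: cos_add cos_diff)
    moreover have "x + \<theta> = real n * \<theta>" "x - \<theta> = real (k + 1) * \<theta>"
      by (simp_all add: x_def 3 algebra_simps)
    ultimately have "cos (real n * \<theta>) = 2 * cos \<theta> * cos x - cos (real (k + 1) * \<theta>)"
      by (metis add_diff_cancel_right')
    then have cos_n: "sqrt 2 * cos (real n * \<theta>) = cos x - sqrt 2 * cos (real (k + 1) * \<theta>)"
      by (simp add: cos field_simps)
    have IH2: "real_of_int (kloosterman (k + 2)) = - (4 * q * cos x)"
      using less.IH[of "k + 2"] 3 by (simp add: q_def x_def)
    have IH1: "real_of_int (kloosterman (k + 1)) = 2 * q * (sqrt 2 * cos (real (k + 1) * \<theta>))"
      using less.IH[of "k + 1"] 3 by (simp add: q_def)
    have "real_of_int (kloosterman n) = - real_of_int (kloosterman (k + 2)) - 2 * real_of_int (kloosterman (k + 1))"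
      unfolding 3 kloosterman_rec(3) by simp
    also have "\<dots> = 4 * q * (sqrt 2 * cos (real n * \<theta>))"
      unfolding IH1 IH2 cos_n by (simp add: algebra_simps)
    also have "\<dots> = - ((-1) ^ n * (2 * sqrt 2 ^ n * cos (real n * \<theta>)))"
      by (simp add: q_def 3 power_add numeral_3_eq_3)
    finally show ?thesis .
  qed
qed

section \<open>Moebius inversion\<close>

text \<open>Only squarefree divisors count, and they correspond to sets of prime factors. The
  alternating sum over these sets expands a product with one factor \<open>1 - 1\<close> for each
  prime factor of \<open>m\<close>.\<close>

lemma sum_moebius_mu:
  assumes "m \<ge> 1"
  shows "(\<Sum>j | j dvd m. moebius_mu j) = of_bool (m = 1)"
proof -
  let ?S = "{j. j dvd m \<and> squarefree j}"
  have fin: "finite {j. j dvd m}" using assms by simp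
  have primes: "prime p" if "p \<in> prime_factors m" for p using that by auto
  have bij: "bij_betw prime_factors ?S (Pow (prime_factors m))"
  proof (rule bij_betw_byWitness[where f' = "\<lambda>X. \<Prod>X"])
    show "\<forall>j\<in>?S. \<Prod>(prime_factors j) = j"
    proof safe
      fix j assume j: "j dvd m" "squarefree j"
      then have "j \<noteq> 0" using assms by auto
      then have "j = (\<Prod>p\<in>prime_factors j. p ^ multiplicity p j)"
        by (simp add: prime_factorization_nat)
      also have "\<dots> = (\<Prod>p\<in>prime_factors j. p)"
        using j(2) \<open>j \<noteq> 0\<close> by (intro prod.cong) (auto simp: squarefree_factorial_semiring')
      finally show "\<Prod>(prime_factors j) = j" by simp
    qed
    show "\<forall>X\<in>Pow (prime_factors m). prime_factors (\<Prod>X) = X"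
    proof safe
      fix X p assume X: "X \<subseteq> prime_factors m"
      then have *: "finite X" "0 \<notin> X" "\<And>p. p \<in> X \<Longrightarrow> prime p"
        using finite_subset by (auto dest: primes)
      have "prime_factors (\<Prod>X) = (\<Union>p\<in>X. prime_factors p)"
        using * prime_factors_prod[of X id] by (simp add: o_def)
      also have "\<dots> = X" using * by (auto simp: prime_prime_factors)
      finally show "p \<in> prime_factors (\<Prod>X) \<Longrightarrow> p \<in> X" "p \<in> X \<Longrightarrow> p \<in> prime_factors (\<Prod>X)" by auto
    qed
    show "prime_factors ` ?S \<subseteq> Pow (prime_factors m)"
      using assms dvd_prime_factors[of m] by auto
    show "(\<lambda>X. \<Prod>X) ` Pow (prime_factors m) \<subseteq> ?S"
    proof safe
      fix X assume X: "X \<subseteq> prime_factors m"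
      then have *: "finite X" "\<And>p. p \<in> X \<Longrightarrow> prime p"
        using finite_subset by (auto dest: primes)
      show "\<Prod>X dvd m"
      proof -
        have "\<Prod>X dvd (\<Prod>p\<in>prime_factors m. p ^ multiplicity p m)"
        proof (rule prod_dvd_prod_subset2)
          show "p dvd p ^ multiplicity p m" if "p \<in> X" for p
            using that X by (intro dvd_power) (auto simp: prime_factors_multiplicity)
        qed (use X in auto)
        also have "\<dots> = m" using assms by (intro prime_factorization_nat[symmetric]) auto
        finally show ?thesis .
      qed
      show "squarefree (\<Prod>X)"
        using * by (intro squarefree_prod_coprime) (auto simp: primes_coprime squarefree_prime)
    qed
  qed
  have "(\<Sum>j | j dvd m. moebius_mu j) = (\<Sum>j\<in>?S. moebius_mu j)"
    using fin by (intro sum.mono_neutral_right) (auto simp: moebius_mu_def)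
  also have "\<dots> = (\<Sum>j\<in>?S. (-1) ^ card (prime_factors j))"
    by (intro sum.cong) (auto simp: moebius_mu_def)
  also have "\<dots> = (\<Sum>X\<in>Pow (prime_factors m). (-1) ^ card X)"
    using sum.reindex_bij_betw[OF bij, of "\<lambda>X. (-1) ^ card X :: int"] by simp
  also have "\<dots> = (\<Prod>p\<in>prime_factors m. 1 - 1)"
    by (subst prod_diff_conv_sum) auto
  also have "\<dots> = of_bool (m = 1)"
  proof (cases "m = 1")
    case False
    then obtain p where "prime p" "p dvd m" using prime_factor_nat by blast
    then have "p \<in> prime_factors m" using assms by (simp add: in_prime_factors_iff)
    then have "(\<Prod>p\<in>prime_factors m. 1 - 1 :: int) = 0" by (intro prod_zero) auto
    then show ?thesis using False by (simp only: of_bool_eq)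
  qed simp
  finally show ?thesis .
qed

text \<open>In \<open>n = j * d * e\<close>, both \<open>j\<close> and \<open>e\<close> are odd
  exactly if \<open>n div d\<close> is. After exchanging the sums, \<open>j\<close> runs over all
  divisors of the odd number \<open>n div d\<close>, and only \<open>d = n\<close> survives.\<close>

lemma moebius_inversion_odd:
  fixes g :: "nat \<Rightarrow> int"
  assumes "n \<ge> 1"
  shows "(\<Sum>j | j dvd n. (if odd j then 1 else 0) * moebius_mu j *
           (\<Sum>d | d dvd n div j \<and> odd (n div j div d). g d)) = g n"
proof -
  let ?R = "\<lambda>j d. odd j \<and> d dvd n div j \<and> odd (n div j div d)"
  have iff: "j dvd n \<and> ?R j d \<longleftrightarrow> (d dvd n \<and> odd (n div d)) \<and> j dvd n div d" for j d
  proof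
    assume *: "j dvd n \<and> ?R j d"
    then obtain e where e: "n = j * (d * e)"
      using assms by (metis dvd_div_mult_self dvdE mult.commute)
    then have "j \<noteq> 0" "d \<noteq> 0" using assms by auto
    with e * show "(d dvd n \<and> odd (n div d)) \<and> j dvd n div d"
      by (simp add: mult.left_commute[of j d])
  next
    assume *: "(d dvd n \<and> odd (n div d)) \<and> j dvd n div d"
    then obtain e where e: "n = d * (j * e)"
      using assms by (metis dvd_div_mult_self dvdE mult.commute)
    then have "j \<noteq> 0" "d \<noteq> 0" using assms by auto
    with e * show "j dvd n \<and> ?R j d" by (simp add: mult.left_commute[of d j])
  qed
  have fin: "finite {j. j dvd n}" using assms by simp
  have "(\<Sum>j | j dvd n. (if odd j then 1 else 0) * moebius_mu j *
           (\<Sum>d | d dvd n div j \<and> odd (n div j div d). g d))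
      = (\<Sum>j | j dvd n. \<Sum>d | d \<in> {d. d dvd n \<and> odd (n div d)} \<and> j dvd n div d. moebius_mu j * g d)"
  proof (rule sum.cong[OF refl])
    fix j assume j: "j \<in> {j. j dvd n}"
    have "{d. d \<in> {d. d dvd n \<and> odd (n div d)} \<and> j dvd n div d}
        = (if odd j then {d. d dvd n div j \<and> odd (n div j div d)} else {})"
      using iff[of j] j by auto
    then show "(if odd j then 1 else 0) * moebius_mu j * (\<Sum>d | d dvd n div j \<and> odd (n div j div d). g d)
        = (\<Sum>d | d \<in> {d. d dvd n \<and> odd (n div d)} \<and> j dvd n div d. moebius_mu j * g d)"
      by (simp add: sum_distrib_left)
  qed
  also have "\<dots> = (\<Sum>d | d dvd n \<and> odd (n div d). \<Sum>j | j \<in> {j. j dvd n} \<and> j dvd n div d. moebius_mu j * g d)"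
    by (rule sum.swap_restrict) (use fin in auto)
  also have "\<dots> = (\<Sum>d | d dvd n \<and> odd (n div d). of_bool (d = n) * g d)"
  proof (rule sum.cong[OF refl])
    fix d assume "d \<in> {d. d dvd n \<and> odd (n div d)}"
    then have d: "d dvd n" "n div d \<ge> 1" "n div d = 1 \<longleftrightarrow> d = n"
      using assms by (auto elim!: dvdE)
    have "{j. j \<in> {j. j dvd n} \<and> j dvd n div d} = {j. j dvd n div d}"
      using d(1) by (metis (lifting) dvd_div_mult_self dvd_triv_left dvd_trans mem_Collect_eq)
    then show "(\<Sum>j | j \<in> {j. j dvd n} \<and> j dvd n div d. moebius_mu j * g d) = of_bool (d = n) * g d"
      using sum_moebius_mu[OF d(2)] d(3) by (simp flip: sum_distrib_right)
  qed
  also have "\<dots> = (\<Sum>d\<in>{n}. g d)"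
    by (rule sum.mono_neutral_cong_right) (use fin assms in auto)
  finally show ?thesis by simp
qed

text \<open>An even exponent gives weight 1 and, when halved, a pair of total degree
  \<open>n\<close>. An odd exponent \<open>k\<close> leaves \<open>w P\<close>, and as
  \<open>P\<close> has even degree \<open>2 * d\<close>, it satisfies
  \<open>n = k * d\<close>.\<close>

lemma SRI_sum_odd_part:
  assumes "n \<ge> 1" and w: "\<And>P. w P * w P = 1"
  shows "SRI_sum w (2 * n) = SRI_sum (\<lambda>_. 1) n +
    (\<Sum>d | d dvd n \<and> odd (n div d). 2 * int d * (\<Sum>P | P \<in> SRI \<and> degree P = 2 * d. w P))"
proof -
  let ?h = "\<lambda>(P, k). int (degree P) * w P ^ k"
  let ?A = "\<lambda>n. {(P, k). P \<in> SRI \<and> 1 \<le> k \<and> k * degree P = n}"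
  let ?O = "{(P, k). P \<in> SRI \<and> odd k \<and> k * degree P = 2 * n}"
  let ?D = "Sigma {d. d dvd n \<and> odd (n div d)} (\<lambda>d. {P. P \<in> SRI \<and> degree P = 2 * d})"
  have even_part: "?A (2 * n) - ?O = (\<lambda>(P, k). (P, 2 * k)) ` ?A n"
    by (auto simp: image_iff elim!: evenE)
  have sub: "?O \<subseteq> ?A (2 * n)" by (auto elim: oddE)
  have w2: "w P ^ (2 * k) = 1" for P k by (simp add: power_mult power2_eq_square w)
  have wodd: "w P ^ k = w P" if "odd k" for P k
    using that by (elim oddE) (simp add: w2)
  have "SRI_sum w (2 * n) = sum ?h (?A (2 * n) - ?O) + sum ?h ?O"
    unfolding SRI_sum_def by (rule sum.subset_diff[OF sub finite_SRI_powers])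
  also have "sum ?h (?A (2 * n) - ?O) = SRI_sum (\<lambda>_. 1) n"
    unfolding even_part SRI_sum_def
    by (subst sum.reindex) (auto simp: inj_on_def w2 intro!: sum.cong)
  also have "sum ?h ?O = (\<Sum>(d, P)\<in>?D. 2 * int d * w P)"
  proof (rule sum.reindex_bij_witness[of _ "\<lambda>(d, P). (P, n div d)" "\<lambda>(P, k). (degree P div 2, P)"])
    fix z assume "z \<in> ?O"
    then obtain P k where z: "z = (P, k)" "P \<in> SRI" "odd k" "k * degree P = 2 * n" by auto
    obtain e where e: "degree P = 2 * e" using SRI_even_degree[OF z(2)] by (elim evenE)
    with z have ke: "n = k * e" by simp
    with assms have e0: "e \<noteq> 0" by auto
    show "(case case z of (P, k) \<Rightarrow> (degree P div 2, P) of (d, P) \<Rightarrow> (P, n div d)) = z"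
      using e0 by (simp add: z(1) e ke)
    show "(case z of (P, k) \<Rightarrow> (degree P div 2, P)) \<in> ?D"
      using z e e0 by (simp add: ke)
    show "(case case z of (P, k) \<Rightarrow> (degree P div 2, P) of (d, P) \<Rightarrow> 2 * int d * w P) = ?h z"
      using z(3) by (simp add: z(1) e wodd)
  next
    fix z assume "z \<in> ?D"
    then obtain d P where z: "z = (d, P)" "d dvd n" "odd (n div d)" "P \<in> SRI" "degree P = 2 * d" by auto
    show "(case case z of (d, P) \<Rightarrow> (P, n div d) of (P, k) \<Rightarrow> (degree P div 2, P)) = z"
      using z by simp
    show "(case z of (d, P) \<Rightarrow> (P, n div d)) \<in> ?O" using z by simp
  qed
  also have "\<dots> = (\<Sum>d | d dvd n \<and> odd (n div d). 2 * int d * (\<Sum>P | P \<in> SRI \<and> degree P = 2 * d. w P))"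
    using assms(1) by (subst sum.Sigma[symmetric]) (auto simp: sum_distrib_left finite_degree_eq)
  finally show ?thesis .
qed

text \<open>By symmetry the coefficient below the leading one is that of \<open>x\<close>, and the
  even degree rules out \<open>x + 1\<close>.\<close>

lemma S2_eq_card_SRI:
  assumes "d \<ge> 1"
  shows "S2 d a = card {P. P \<in> SRI \<and> degree P = 2 * d \<and> coeff P 1 = a}"
proof -
  have "lead_coeff f = 1 \<and> irreducible f \<and> degree f = 2 * d \<and> self_reciprocal f \<and> coeff f (2 * d - 1) = a
      \<longleftrightarrow> f \<in> SRI \<and> degree f = 2 * d \<and> coeff f 1 = a" for f :: "bit poly"
  proof (cases "irreducible f \<and> degree f = 2 * d \<and> self_reciprocal f")
    case True
    then have "f \<noteq> 0" "f \<noteq> [:1, 1:]" by auto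
    moreover have "lead_coeff f = 1" using \<open>f \<noteq> 0\<close> by simp
    moreover have "coeff f (2 * d - 1) = coeff f 1"
      using self_reciprocal_coeff[of f 1] True assms by simp
    ultimately show ?thesis using True by (simp only: SRI_def mem_Collect_eq) blast
  qed (auto simp: SRI_def)
  then show ?thesis by (simp add: S2_def)
qed

section \<open>Divisor sums of \<open>S2\<close>\<close>

lemma S2_sum_sign:
  assumes "d \<ge> 1"
  shows "(\<Sum>P | P \<in> SRI \<and> degree P = 2 * d. 1) = int (S2 d 0) + int (S2 d 1)"
    and "(\<Sum>P | P \<in> SRI \<and> degree P = 2 * d. coeff1_sign P) = int (S2 d 0) - int (S2 d 1)"
proof -
  let ?A = "\<lambda>a. {P. P \<in> SRI \<and> degree P = 2 * d \<and> coeff P 1 = a}"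
  have U: "{P. P \<in> SRI \<and> degree P = 2 * d} = ?A 0 \<union> ?A 1" by auto
  have fin: "finite (?A a)" for a by (rule finite_subset[OF _ finite_degree_le[of "2 * d"]]) auto
  have split: "sum f (?A 0 \<union> ?A 1) = sum f (?A 0) + sum f (?A 1)" for f :: "bit poly \<Rightarrow> int"
    by (rule sum.union_disjoint[OF fin fin]) auto
  show "(\<Sum>P | P \<in> SRI \<and> degree P = 2 * d. 1) = int (S2 d 0) + int (S2 d 1)"
    "(\<Sum>P | P \<in> SRI \<and> degree P = 2 * d. coeff1_sign P) = int (S2 d 0) - int (S2 d 1)"
    unfolding U S2_eq_card_SRI[OF assms] split by (simp_all add: coeff1_sign_def)
qed

lemma S2_divisor_sum:
  assumes "n \<ge> 1"
  shows "(\<Sum>d | d dvd n \<and> odd (n div d). 4 * int d * int (S2 d 1)) = 2 ^ n + 1 + kloosterman n"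
    and "(\<Sum>d | d dvd n \<and> odd (n div d). 4 * int d * int (S2 d 0)) = 2 ^ n - 1 - kloosterman n"
proof -
  let ?D = "{d. d dvd n \<and> odd (n div d)}"
  have d1: "d \<ge> 1" if "d \<in> ?D" for d using that assms by (cases d) auto
  have "(\<Sum>d\<in>?D. 2 * int d * (int (S2 d 0) + int (S2 d 1))) = SRI_sum (\<lambda>_. 1) (2 * n) - SRI_sum (\<lambda>_. 1) n"
    by (subst SRI_sum_odd_part[OF assms]) (use d1 S2_sum_sign(1) in \<open>auto intro!: sum.cong\<close>)
  \<comment> \<open>Both identities contain the same \<open>NSRI_sum\<close> with trivial weight,
    which cancels in the difference.\<close>
  also have "\<dots> = 2 ^ n"
    using palin_count_identity[OF assms] all_poly_count_identity[OF assms] by simp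
  finally have plus: "(\<Sum>d\<in>?D. 2 * int d * (int (S2 d 0) + int (S2 d 1))) = 2 ^ n" .
  have "(\<Sum>d\<in>?D. 2 * int d * (int (S2 d 0) - int (S2 d 1))) = SRI_sum coeff1_sign (2 * n) - SRI_sum (\<lambda>_. 1) n"
    by (subst SRI_sum_odd_part[OF assms coeff1_sign_square])
      (use d1 S2_sum_sign(2) in \<open>auto intro!: sum.cong\<close>)
  \<comment> \<open>Here the \<open>NSRI_sum\<close> with weight \<open>coeff1_sign\<close> cancels
    against the one inside \<open>kloosterman n\<close>.\<close>
  also have "\<dots> = - 1 - kloosterman n"
    using palin_sign_identity[OF assms] by (simp add: kloosterman_def)
  finally have minus: "(\<Sum>d\<in>?D. 2 * int d * (int (S2 d 0) - int (S2 d 1))) = - 1 - kloosterman n" .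
  have "(\<Sum>d\<in>?D. 4 * int d * int (S2 d 1)) = (\<Sum>d\<in>?D. 2 * int d * (int (S2 d 0) + int (S2 d 1)))
      - (\<Sum>d\<in>?D. 2 * int d * (int (S2 d 0) - int (S2 d 1)))"
    unfolding sum_subtractf[symmetric] by (intro sum.cong) (auto simp: algebra_simps)
  then show "(\<Sum>d\<in>?D. 4 * int d * int (S2 d 1)) = 2 ^ n + 1 + kloosterman n" using plus minus by simp
  have "(\<Sum>d\<in>?D. 4 * int d * int (S2 d 0)) = (\<Sum>d\<in>?D. 2 * int d * (int (S2 d 0) + int (S2 d 1)))
      + (\<Sum>d\<in>?D. 2 * int d * (int (S2 d 0) - int (S2 d 1)))"
    unfolding sum.distrib[symmetric] by (intro sum.cong) (auto simp: algebra_simps)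
  then show "(\<Sum>d\<in>?D. 4 * int d * int (S2 d 0)) = 2 ^ n - 1 - kloosterman n" using plus minus by simp
qed

theorem theorem4:
  fixes n :: nat
  assumes "n \<ge> 1"
  defines "\<theta> \<equiv> arccos (1 / (2 * sqrt 2))"
  shows "(real (S2 n 1) = 1 / (4 * real n) *
           (\<Sum>j | j dvd n. (if odd j then 1 else 0) * real_of_int (moebius_mu j) *
              (2 ^ (n div j) + 1 - (-1) ^ (n div j) * 2 powr (real (n div j) / 2 + 1)
                 * cos (real n * \<theta> / real j)))) \<and>
         (real (S2 n 0) = 1 / (4 * real n) *
           (\<Sum>j | j dvd n. (if odd j then 1 else 0) * real_of_int (moebius_mu j) *
              (2 ^ (n div j) - 1 + (-1) ^ (n div j) * 2 powr (real (n div j) / 2 + 1)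
                 * cos (real n * \<theta> / real j))))"
proof -
  \<comment> \<open>The quotient \<open>n div j\<close> is exact, so the real power of 2 is twice a
    natural power of \<open>sqrt 2\<close>, and the oscillating term is the closed form of a
    \<open>kloosterman\<close> value with the sign reversed.\<close>
  have K: "(-1) ^ (n div j) * 2 powr (real (n div j) / 2 + 1) * cos (real n * \<theta> / real j)
      = - real_of_int (kloosterman (n div j))" if "j dvd n" for j
  proof -
    obtain m where m: "n = j * m" using \<open>j dvd n\<close> ..
    then have jm: "j \<noteq> 0" "m \<ge> 1" "n div j = m" using assms(1) by auto
    have "2 powr (real m / 2 + 1) = 2 * sqrt 2 ^ m"
      by (simp add: powr_add powr_half_sqrt_powr powr_realpow real_sqrt_power)
    moreover have "real n * \<theta> / real j = real m * \<theta>" using jm m by simp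
    ultimately show ?thesis
      using kloosterman_cos[OF jm(2)] unfolding jm(3) \<theta>_def by simp
  qed
  \<comment> \<open>The inversion is done once for both values of \<open>a\<close>, applied to
    \<open>4 * d * S2 d a\<close>; \<open>r\<close> stands for the known value of its divisor
    sum.\<close>
  have main: "real (S2 n a) = 1 / (4 * real n) *
      (\<Sum>j | j dvd n. (if odd j then 1 else 0) * real_of_int (moebius_mu j) * real_of_int (r (n div j)))"
    if r: "\<And>m. m \<ge> 1 \<Longrightarrow> (\<Sum>d | d dvd m \<and> odd (m div d). 4 * int d * int (S2 d a)) = r m" for a r
  proof -
    have "4 * int n * int (S2 n a) = (\<Sum>j | j dvd n. (if odd j then 1 else 0) * moebius_mu j *
        (\<Sum>d | d dvd n div j \<and> odd (n div j div d). 4 * int d * int (S2 d a)))"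
      by (rule moebius_inversion_odd[OF assms(1), symmetric])
    also have "\<dots> = (\<Sum>j | j dvd n. (if odd j then 1 else 0) * moebius_mu j * r (n div j))"
      using assms(1) by (intro sum.cong refl) (auto simp: r elim!: dvdE)
    finally have "real_of_int (4 * int n * int (S2 n a))
        = (\<Sum>j | j dvd n. real_of_int ((if odd j then 1 else 0) * moebius_mu j * r (n div j)))"
      unfolding of_int_sum[symmetric] by (rule arg_cong)
    also have "\<dots> = (\<Sum>j | j dvd n. (if odd j then 1 else 0) * real_of_int (moebius_mu j) * real_of_int (r (n div j)))"
      by (intro sum.cong) auto
    finally have "4 * real n * real (S2 n a)
        = (\<Sum>j | j dvd n. (if odd j then 1 else 0) * real_of_int (moebius_mu j) * real_of_int (r (n div j)))"
      by simp
    then show ?thesis using assms(1) by (simp add: field_simps)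
  qed
  have "real (S2 n 1) = 1 / (4 * real n) *
           (\<Sum>j | j dvd n. (if odd j then 1 else 0) * real_of_int (moebius_mu j) *
              (2 ^ (n div j) + 1 - (-1) ^ (n div j) * 2 powr (real (n div j) / 2 + 1)
                 * cos (real n * \<theta> / real j)))"
  proof -
    have "real (S2 n 1) = 1 / (4 * real n) * (\<Sum>j | j dvd n. (if odd j then 1 else 0) *
        real_of_int (moebius_mu j) * real_of_int (2 ^ (n div j) + 1 + kloosterman (n div j)))"
      by (rule main) (rule S2_divisor_sum(1))
    also have "(\<Sum>j | j dvd n. (if odd j then 1 else 0) *
          real_of_int (moebius_mu j) * real_of_int (2 ^ (n div j) + 1 + kloosterman (n div j)))
        = (\<Sum>j | j dvd n. (if odd j then 1 else 0) * real_of_int (moebius_mu j) *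
              (2 ^ (n div j) + 1 - (-1) ^ (n div j) * 2 powr (real (n div j) / 2 + 1)
                 * cos (real n * \<theta> / real j)))"
      by (intro sum.cong refl) (simp add: K)
    finally show ?thesis .
  qed
  moreover have "real (S2 n 0) = 1 / (4 * real n) *
           (\<Sum>j | j dvd n. (if odd j then 1 else 0) * real_of_int (moebius_mu j) *
              (2 ^ (n div j) - 1 + (-1) ^ (n div j) * 2 powr (real (n div j) / 2 + 1)
                 * cos (real n * \<theta> / real j)))"
  proof -
    have "real (S2 n 0) = 1 / (4 * real n) * (\<Sum>j | j dvd n. (if odd j then 1 else 0) *
        real_of_int (moebius_mu j) * real_of_int (2 ^ (n div j) - 1 - kloosterman (n div j)))"
      by (rule main) (rule S2_divisor_sum(2))
    also have "(\<Sum>j | j dvd n. (if odd j then 1 else 0) *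
          real_of_int (moebius_mu j) * real_of_int (2 ^ (n div j) - 1 - kloosterman (n div j)))
        = (\<Sum>j | j dvd n. (if odd j then 1 else 0) * real_of_int (moebius_mu j) *
              (2 ^ (n div j) - 1 + (-1) ^ (n div j) * 2 powr (real (n div j) / 2 + 1)
                 * cos (real n * \<theta> / real j)))"
      by (intro sum.cong refl) (simp add: K)
    finally show ?thesis .
  qed
  ultimately show ?thesis ..
qed

end
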